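(* Let $\sigma$ and $\tau$ be types of a positive integer $n$. The coefficient of $h^\otimes_\tau$ in the $h^\otimes$-expansion of $E_\sigma$ is $$(-1)^{\mathrm{area}(\tau)}\sum_{T^*}\mathrm{psgn}^*(T^* ),$$ where the sum is over all labeled polywrapping block tabloids $T^*$ of shape $\sigma$ and content $\tau$.
   Context: **Types.** A composition is a finite (possibly empty) list $\beta$ of positive integers, with $\mathrm{area}(\beta)$ the sum of its entries and $\ell(\beta)$ its length. A partition is a weakly decreasing composition; $\mathrm{sort}(\beta)$ is the partition obtained by sorting $\beta$. An ordered type of $n$ is a sequence $\delta=(\delta|_1,\delta|_2,\ldots)$ of compositions with $\sum_i i\,\mathrm{area}(\delta|_i)=n$, written $\delta=1^{\delta|_1}2^{\delta|_2}\cdots$; $\ell(\delta)=\sum_i\ell(\delta|_i)$ and $\mathrm{area}(\delta)=\sum_i\mathrm{area}(\delta|_i)$. A type is an ordered type with all $\delta|_i$ partitions, and $\mathrm{psort}(\delta)$ is the type obtained by replacing each $\delta|_i$ by $\mathrm{sort}(\delta|_i)$. A block $d^r$ ($d,r\ge1$) is the ordered type with $\delta|_d=(r)$ and all other $\delta|_i$ empty. A type $\tau$ is identified with the multiset of its blocks (one copy of $d^r$ for each part $r$ of $\tau|_d$), and we list its blocks as $d_1^{r_1}\cdots d_k^{r_k}$. An $r$-ordered type is an ordered type $\delta$ with $\mathrm{area}(\delta|_i)$ divisible by $r$ for all $i$; $\mathrm{OTyp}_r(n)$ is the set of $r$-ordered types of $n$. **Polysymmetric functions.** Let $x_{ij}$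 ($i,j\ge1$) be commuting indeterminates with $\deg x_{ij}=i$. $\mathrm{PSym}$ is the $\mathbb{Q}$-algebra of bounded-degree formal power series in the $x_{ij}$ invariant under swapping $x_{ij}$ and $x_{ik}$ for all $i,j,k$; $\mathrm{PSym}(n)$ is its degree $n$ part. For an ordered type $\delta$, $h^\otimes_\delta=\prod_i h_{\delta|_i}(x_{i1},x_{i2},\ldots)$ where $h_\beta=\prod_j h_{\beta_j}$; $\{h^\otimes_\tau\}$ over types $\tau$ of $n$ is a basis of $\mathrm{PSym}(n)$, and the $h^\otimes$-expansion is the expansion in this basis. $E_d$ is the sum of $(-1)^{\mathrm{len}(f)}f$ over all square-free monomials $f$ of degree $d$ in the $x_{ij}$, where $\mathrm{len}(f)$ is the number of variables in $f$; $E_{d^r}$ is obtained from $E_d$ by replacing each $x_{ij}$ by $x_{ij}^r$; $E_\sigma=\prod_{i=1}^kE_{d_i^{r_i}}$ for $\sigma=d_1^{r_1}\cdots d_k^{r_k}$. **The function $\hat{s}_r$.** For an $r$-tuple $w=(w_0,\ldots,w_{r-1})$ of non-negative integers, let $v_i$ be the remainder of $w_i+i$ upon division by $r$; $\hat{s}_r(w)=(-1)^{\#\{i<j:\,v_i>v_j\}}$ if the $v_i$ are distinct, and $0$ otherwise. For a composition $\beta$ with $\ell(\beta)\le r$, $\hat{s}_r(\beta)=\sum_w\hat{s}_r(w)$ over all $r$-tuples $w$ of non-negative integers that become $\beta$ on deleting zeros; if $\ell(\beta)>r$, $\hat{s}_r(\beta)=0$. For an ordered type $\delta$, $\hat{s}_r(\delta)=\prod_i\hat{s}_r(\delta|_i)$.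 **Wrappings and polywrappings.** View the block $d^r$ as an array of boxes with $d$ rows and $r$ columns. For $k\mid d$, divide the rows from top to bottom into $d/k$ "$k$-sheets" of $k$ consecutive rows; list the $dr/k$ columns of $k$-sheets in reading order (first sheet left to right, then second sheet left to right, etc.). For a composition $\beta=(\beta_1,\ldots,\beta_l)$ of $dr/k$, the $k$-wrapping of $d^r$ of content $\beta$ is the set partition $(B_1,\ldots,B_l)$ of the boxes where $B_1$ is the first $\beta_1$ sheet-columns, $B_2$ the next $\beta_2$, etc.; the $B_j$ are called rectangles of height $k$. Given $\gamma\in\mathrm{OTyp}_r(dr)$, the polywrapping $D$ of $d^r$ of ordered content $\gamma$ is obtained by dividing the $d$ rows, from top to bottom for $k=1,2,\ldots$, into consecutive groups of $k\,\mathrm{area}(\gamma|_k)/r$ rows, and putting on the $k$th group the $k$-wrapping $D_k$ of content $\gamma|_k$. **Labeled polywrappings.** A labeled polywrapping $D^*$ of $d^r$ of ordered content $\mathrm{pocon}(D^* )=\gamma$ is the polywrapping $D$ of ordered content $\gamma$ together with, for each $k$, a labeling of the rectangles of height $k$ by labels from $\{1,\ldots,r\}$ such that, reading the rectangles $B_1,B_2,\ldots$ of $D_k$ in order, the labels start at $1$, weakly increase, and use consecutive values (not all values in $\{1,\ldots,r\}$ need occur). The ordered type of the labeling is the ordered type $\delta$ for which the $i$th entry of $\delta|_k$ is the total number of boxes in the height-$k$ rectangles labeled $i$, divided by $k$. Set $\mathrm{psgn}^*(D^* )=(-1)^{\mathrm{area}(\gamma)-\ell(\gamma)}\hat{s}_r(\delta)$.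 **Labeled polywrapping block tabloids.** A labeled polywrapping block tabloid $T^*$ of shape $\sigma=d_1^{r_1}\cdots d_k^{r_k}$ and content $\tau$ is a list $(D^*_{(1)},\ldots,D^*_{(k)})$ where $D^*_{(i)}$ is a labeled polywrapping of $d_i^{r_i}$ and the multiset union of the blocks of $\mathrm{psort}(\mathrm{pocon}(D^*_{(i)}))$, $1\le i\le k$, equals $\tau$. Set $\mathrm{psgn}^*(T^* )=\prod_{i=1}^k\mathrm{psgn}^*(D^*_{(i)})$. *)

theory Defs
  imports
    Complex_Main
    "HOL-Library.Poly_Mapping"
    "HOL-Library.Multiset"
    "HOL-Combinatorics.Transposition"
begin

section \<open>Formal power series in the variables \<open>x\<^sub>i\<^sub>j\<close>\<close>

text \<open>
  A monomial maps \<open>(i, j)\<close> to the exponent of \<open>x\<^sub>i\<^sub>j\<close>.  The variables proper are those with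
  \<open>i, j \<ge> 1\<close>; the remaining pairs exist only because the index type is \<open>nat \<times> nat\<close>, and they
  occur in none of the series defined below.
\<close>

type_synonym monomial = "(nat \<times> nat) \<Rightarrow>\<^sub>0 nat"

definition xvars :: "(nat \<times> nat) set" where
  "xvars = {1..} \<times> {1..}"

definition mdeg :: "monomial \<Rightarrow> nat" where
  "mdeg f = (\<Sum>v\<in>Poly_Mapping.keys f. fst v * Poly_Mapping.lookup f v)"

datatype pser = PSer (coeff: "monomial \<Rightarrow> rat")

lemma pser_eqI: "(\<And>f. coeff F f = coeff G f) \<Longrightarrow> F = G"
  by (cases F, cases G) auto

lemma mdeg_eq:
  assumes "finite A" "Poly_Mapping.keys f \<subseteq> A"
  shows "mdeg f = (\<Sum>v\<in>A. fst v * Poly_Mapping.lookup f v)"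
  unfolding mdeg_def using assms
  by (intro sum.mono_neutral_left) (auto simp: in_keys_iff)

lemma mdeg_add: "mdeg (a + b) = mdeg a + mdeg b"
proof -
  let ?A = "Poly_Mapping.keys a \<union> Poly_Mapping.keys b"
  have "Poly_Mapping.keys (a + b) \<subseteq> ?A" by (rule keys_add)
  then show ?thesis
    by (simp add: mdeg_eq[of ?A] lookup_add sum.distrib distrib_left)
qed

lemma keys_add_nat:
  "Poly_Mapping.keys (a + b :: monomial) = Poly_Mapping.keys a \<union> Poly_Mapping.keys b"
  by (auto simp: in_keys_iff lookup_add)

lemma finite_splits: "finite {(a, b). a + b = (f :: monomial)}"
proof -
  let ?l = "Poly_Mapping.lookup :: monomial \<Rightarrow> _"
  let ?K = "Poly_Mapping.keys f"
  let ?S = "{g. \<forall>x. (x \<in> ?K \<longrightarrow> g x \<in> {..(\<Sum>v\<in>?K. ?l f v)}) \<and> (x \<notin> ?K \<longrightarrow> g x = 0)}"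
  have "finite ?S" by (rule finite_set_of_finite_funs) auto
  moreover have "?l ` {a. \<exists>b. a + b = f} \<subseteq> ?S"
  proof clarify
    fix a b x assume f: "f = a + b"
    have le: "?l a x \<le> ?l (a + b) x" for x by (simp add: lookup_add)
    have "?l (a + b) x \<le> (\<Sum>v\<in>Poly_Mapping.keys (a + b). ?l (a + b) v)"
      if "x \<in> Poly_Mapping.keys (a + b)" using that by (intro member_le_sum) auto
    with le[of x] show "(x \<in> Poly_Mapping.keys (a + b) \<longrightarrow>
        ?l a x \<in> {..(\<Sum>v\<in>Poly_Mapping.keys (a + b). ?l (a + b) v)}) \<and>
        (x \<notin> Poly_Mapping.keys (a + b) \<longrightarrow> ?l a x = 0)"
      by (auto simp: in_keys_iff)
  qed
  ultimately have "finite (?l ` {a. \<exists>b. a + b = f})" by (rule finite_subset[rotated])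
  then have fin: "finite {a. \<exists>b. a + b = f}"
    by (rule finite_imageD) (auto simp: inj_on_def intro: poly_mapping_eqI)
  have "{(a, b). a + b = f} \<subseteq> {a. \<exists>b. a + b = f} \<times> {a. \<exists>b. a + b = f}"
  proof clarify
    fix a b :: monomial
    have "b + a = a + b" by (rule add.commute)
    then show "a \<in> {x. \<exists>y. x + y = a + b} \<and> b \<in> {x. \<exists>y. x + y = a + b}" by blast
  qed
  then show ?thesis using fin by (meson finite_SigmaI finite_subset)
qed

instantiation pser :: comm_ring_1
begin

definition "0 = PSer (\<lambda>_. 0)"
definition "1 = PSer (\<lambda>f. if f = 0 then 1 else 0)"
definition "F + G = PSer (\<lambda>f. coeff F f + coeff G f)"
definition "F - G = PSer (\<lambda>f. coeff F f - coeff G f)"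
definition "- F = PSer (\<lambda>f. - coeff F f)"
definition "F * G = PSer (\<lambda>f. \<Sum>(a, b) \<in> {(a, b). a + b = f}. coeff F a * coeff G b)"

instance
proof
  fix F G H :: pser
  show "F * G * H = F * (G * H)"
  proof (rule pser_eqI)
    fix f
    let ?P = "\<lambda>f. {(a, b). a + b = (f :: monomial)}"
    have "coeff (F * G * H) f =
        (\<Sum>((a, b), (c, d)) \<in> Sigma (?P f) (\<lambda>(a, b). ?P a). coeff F c * coeff G d * coeff H b)"
      by (subst sum.Sigma[symmetric])
        (auto simp: times_pser_def sum_distrib_right finite_splits intro!: sum.cong)
    also have "\<dots> =
        (\<Sum>((a, b), (c, d)) \<in> Sigma (?P f) (\<lambda>(a, b). ?P b). coeff F a * (coeff G c * coeff H d))"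
      by (rule sum.reindex_bij_witness
          [where i = "\<lambda>((a, b), (c, d)). ((a + c, d), (a, c))"
             and j = "\<lambda>((a, b), (c, d)). ((c, d + b), (d, b))"])
        (auto simp: ac_simps)
    also have "\<dots> = coeff (F * (G * H)) f"
      by (subst sum.Sigma[symmetric])
        (auto simp: times_pser_def sum_distrib_left finite_splits intro!: sum.cong)
    finally show "coeff (F * G * H) f = coeff (F * (G * H)) f" .
  qed
  show "F * G = G * F"
    unfolding times_pser_def
    by (intro arg_cong[where f = PSer] ext
        sum.reindex_bij_witness[where i = "\<lambda>(a, b). (b, a)" and j = "\<lambda>(a, b). (b, a)"])
      (auto simp: ac_simps)
  show "1 * F = F"
  proof (rule pser_eqI)
    fix f
    have "coeff (1 * F) f = (\<Sum>(a, b) \<in> {(0, f)}. coeff 1 a * coeff F b)"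
      unfolding times_pser_def pser.sel
      by (rule sum.mono_neutral_right) (auto simp: finite_splits one_pser_def split: if_splits)
    then show "coeff (1 * F) f = coeff F f" by (simp add: one_pser_def)
  qed
  show "(F + G) * H = F * H + G * H"
    by (rule pser_eqI)
      (auto simp: times_pser_def plus_pser_def distrib_right simp flip: sum.distrib
        intro!: sum.cong)
  show "(0::pser) \<noteq> 1"
    by (auto simp: zero_pser_def one_pser_def dest!: fun_cong[of _ _ 0])
qed (auto simp: zero_pser_def plus_pser_def minus_pser_def uminus_pser_def)

end

definition pscale :: "rat \<Rightarrow> pser \<Rightarrow> pser" where
  "pscale q F = PSer (\<lambda>f. q * coeff F f)"

interpretation pser: vector_space pscale
  by unfold_locales (auto simp: pscale_def plus_pser_def algebra_simps)

definition pinvariant :: "pser \<Rightarrow> bool" where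
  "pinvariant F \<longleftrightarrow> (\<forall>i j k f. i \<ge> 1 \<longrightarrow> j \<ge> 1 \<longrightarrow> k \<ge> 1 \<longrightarrow>
     coeff F (Poly_Mapping.map_key (transpose (i, j) (i, k)) f) = coeff F f)"

definition PSym :: "pser set" where
  "PSym = {F. (\<forall>f. coeff F f \<noteq> 0 \<longrightarrow> Poly_Mapping.keys f \<subseteq> xvars) \<and>
              (\<exists>N. \<forall>f. coeff F f \<noteq> 0 \<longrightarrow> mdeg f \<le> N) \<and> pinvariant F}"

definition PSym_deg :: "nat \<Rightarrow> pser set" where
  "PSym_deg n = {F \<in> PSym. \<forall>f. coeff F f \<noteq> 0 \<longrightarrow> mdeg f = n}"

lemma coeff_times_nonzero:
  assumes "coeff (F * G) f \<noteq> 0"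
  obtains a b where "f = a + b" "coeff F a \<noteq> 0" "coeff G b \<noteq> 0"
proof -
  from assms obtain p where "p \<in> {(a, b). a + b = f}" "(\<lambda>(a, b). coeff F a * coeff G b) p \<noteq> 0"
    unfolding times_pser_def pser.sel by (rule sum.not_neutral_contains_not_neutral)
  with that show thesis by auto
qed

lemma lookup_map_key_transpose:
  "Poly_Mapping.lookup (Poly_Mapping.map_key (transpose u v) f) x =
   Poly_Mapping.lookup f (transpose u v x)"
  by (simp add: map_key.rep_eq)

lemma map_key_transpose_twice:
  "Poly_Mapping.map_key (transpose u v) (Poly_Mapping.map_key (transpose u v) f) = f"
  by (rule poly_mapping_eqI) (simp add: lookup_map_key_transpose)

lemma pinvariant_times:
  assumes "pinvariant F" "pinvariant G"
  shows "pinvariant (F * G)"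
  unfolding pinvariant_def
proof (intro allI impI)
  fix i j k :: nat and f
  assume ijk: "i \<ge> 1" "j \<ge> 1" "k \<ge> 1"
  let ?m = "Poly_Mapping.map_key (transpose (i, j) (i, k)) :: monomial \<Rightarrow> monomial"
  have inv: "coeff F (?m a) = coeff F a" "coeff G (?m a) = coeff G a" for a
    using assms ijk unfolding pinvariant_def by blast+
  have add: "?m (a + b) = ?m a + ?m b" for a b
    by (rule map_key_plus) simp
  have split: "?m a + ?m b = g" if "a + b = ?m g" for a b g
    by (simp add: map_key_transpose_twice that flip: add)
  show "coeff (F * G) (?m f) = coeff (F * G) f"
    unfolding times_pser_def pser.sel
    by (rule sum.reindex_bij_witness
        [where i = "\<lambda>(a, b). (?m a, ?m b)" and j = "\<lambda>(a, b). (?m a, ?m b)"])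
      (auto simp: map_key_transpose_twice inv split add)
qed

lemma PSym_degD:
  assumes "F \<in> PSym_deg m" "coeff F f \<noteq> 0"
  shows "Poly_Mapping.keys f \<subseteq> xvars" "mdeg f = m"
  using assms by (auto simp: PSym_deg_def PSym_def)

lemma PSym_degI:
  assumes "\<And>f. coeff F f \<noteq> 0 \<Longrightarrow> Poly_Mapping.keys f \<subseteq> xvars"
    and "\<And>f. coeff F f \<noteq> 0 \<Longrightarrow> mdeg f = m" and "pinvariant F"
  shows "F \<in> PSym_deg m"
proof -
  have "\<exists>N. \<forall>f. coeff F f \<noteq> 0 \<longrightarrow> mdeg f \<le> N"
    using assms(2) by (intro exI[of _ m]) simp
  with assms show ?thesis by (simp add: PSym_deg_def PSym_def)
qed

lemma PSym_deg_times:
  assumes "F \<in> PSym_deg m" "G \<in> PSym_deg n"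
  shows "F * G \<in> PSym_deg (m + n)"
proof (rule PSym_degI)
  show "pinvariant (F * G)"
    using assms by (intro pinvariant_times) (auto simp: PSym_deg_def PSym_def)
  fix f assume "coeff (F * G) f \<noteq> 0"
  then obtain a b where f: "f = a + b" and ab: "coeff F a \<noteq> 0" "coeff G b \<noteq> 0"
    by (rule coeff_times_nonzero)
  show "Poly_Mapping.keys f \<subseteq> xvars"
    using PSym_degD(1)[OF assms(1) ab(1)] PSym_degD(1)[OF assms(2) ab(2)]
    by (simp add: f keys_add_nat)
  show "mdeg f = m + n"
    using PSym_degD(2)[OF assms(1) ab(1)] PSym_degD(2)[OF assms(2) ab(2)]
    by (simp add: f mdeg_add)
qed

lemma PSym_deg_one: "1 \<in> PSym_deg 0"
proof (rule PSym_degI)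
  have "Poly_Mapping.map_key (transpose u v) f = 0 \<longleftrightarrow> f = 0" for u v and f :: monomial
    using map_key_transpose_twice[of u v f] by (auto simp: map_key_zero)
  then show "pinvariant 1"
    by (simp add: pinvariant_def one_pser_def)
qed (auto simp: one_pser_def mdeg_def split: if_splits)

lemma PSym_deg_prod:
  assumes "finite A" "\<And>x. x \<in> A \<Longrightarrow> F x \<in> PSym_deg (m x)"
  shows "prod F A \<in> PSym_deg (sum m A)"
  using assms by (induction A rule: finite_induct) (auto intro: PSym_deg_one PSym_deg_times)

lemma PSym_deg_prod_mset:
  assumes "\<And>x. x \<in># A \<Longrightarrow> F x \<in> PSym_deg (m x)"
  shows "(\<Prod>x\<in>#A. F x) \<in> PSym_deg (\<Sum>x\<in>#A. m x)"
  using assms by (induction A) (auto intro: PSym_deg_one PSym_deg_times)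

lemma keys_map_key_transpose:
  "Poly_Mapping.keys (Poly_Mapping.map_key (transpose u v) f) = transpose u v ` Poly_Mapping.keys f"
  by (simp add: keys_map_key bij_vimage_eq_inv_image)

lemma sum_map_key_transpose:
  "(\<Sum>x\<in>Poly_Mapping.keys (Poly_Mapping.map_key (transpose u v) f).
      c x (Poly_Mapping.lookup (Poly_Mapping.map_key (transpose u v) f) x)) =
   (\<Sum>x\<in>Poly_Mapping.keys f. c (transpose u v x) (Poly_Mapping.lookup f x))"
  unfolding keys_map_key_transpose
  by (subst sum.reindex) (simp_all add: map_key.rep_eq)


section \<open>Ordered types\<close>

text \<open>
  An ordered type is the function \<open>i \<mapsto> \<delta>|\<^sub>i\<close>.  Its index is at least \<open>1\<close>, so the entry at \<open>0\<close>
  is required to be empty.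
\<close>

type_synonym otype = "nat \<Rightarrow> nat list"

definition is_otype :: "otype \<Rightarrow> bool" where
  "is_otype \<delta> \<longleftrightarrow> \<delta> 0 = [] \<and> finite {i. \<delta> i \<noteq> []} \<and> (\<forall>i. \<forall>m\<in>set (\<delta> i). m \<ge> 1)"

definition otype_weight :: "otype \<Rightarrow> nat" where
  "otype_weight \<delta> = (\<Sum>i | \<delta> i \<noteq> []. i * sum_list (\<delta> i))"

definition otype_area :: "otype \<Rightarrow> nat" where
  "otype_area \<delta> = (\<Sum>i | \<delta> i \<noteq> []. sum_list (\<delta> i))"

definition otype_length :: "otype \<Rightarrow> nat" where
  "otype_length \<delta> = (\<Sum>i | \<delta> i \<noteq> []. length (\<delta> i))"

definition OTyp :: "nat \<Rightarrow> otype set" where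
  "OTyp n = {\<delta>. is_otype \<delta> \<and> otype_weight \<delta> = n}"

definition Typ :: "nat \<Rightarrow> otype set" where
  "Typ n = {\<delta> \<in> OTyp n. \<forall>i. sorted_wrt (\<ge>) (\<delta> i)}"

definition OTyp_div :: "nat \<Rightarrow> nat \<Rightarrow> otype set" where
  "OTyp_div r n = {\<delta> \<in> OTyp n. \<forall>i. r dvd sum_list (\<delta> i)}"

definition psort :: "otype \<Rightarrow> otype" where
  "psort \<delta> = (\<lambda>i. rev (sort (\<delta> i)))"

text \<open>The block \<open>d\<^sup>r\<close> is represented by the pair \<open>(d, r)\<close>.\<close>

definition blocks :: "otype \<Rightarrow> (nat \<times> nat) multiset" where
  "blocks \<tau> = (\<Sum>d | \<tau> d \<noteq> []. image_mset (Pair d) (mset (\<tau> d)))"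


section \<open>The polysymmetric functions \<open>h\<^sup>\<otimes>\<close> and \<open>E\<close>\<close>

text \<open>The complete homogeneous symmetric function \<open>h\<^sub>m(x\<^sub>i\<^sub>1, x\<^sub>i\<^sub>2, \<dots>)\<close>.\<close>

definition h_sym :: "nat \<Rightarrow> nat \<Rightarrow> pser" where
  "h_sym i m = PSer (\<lambda>f. if Poly_Mapping.keys f \<subseteq> {i} \<times> {1..} \<and>
     (\<Sum>v\<in>Poly_Mapping.keys f. Poly_Mapping.lookup f v) = m then 1 else 0)"

definition h_tensor :: "otype \<Rightarrow> pser" where
  "h_tensor \<delta> = (\<Prod>i | \<delta> i \<noteq> []. prod_list (map (h_sym i) (\<delta> i)))"

definition E_deg :: "nat \<Rightarrow> pser" where
  "E_deg d = PSer (\<lambda>f. if Poly_Mapping.keys f \<subseteq> xvars \<and> (\<forall>v. Poly_Mapping.lookup f v \<le> 1) \<and>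
     mdeg f = d then (-1) ^ card (Poly_Mapping.keys f) else 0)"

text \<open>
  Replacing every \<open>x\<^sub>i\<^sub>j\<close> by its \<open>r\<close>-th power (\<open>r \<ge> 1\<close>): only monomials whose exponents are all
  divisible by \<open>r\<close> survive, each arising from the monomial with the exponents divided by \<open>r\<close>.
\<close>

definition subst_power :: "nat \<Rightarrow> pser \<Rightarrow> pser" where
  "subst_power r F = PSer (\<lambda>f. if \<forall>v. r dvd Poly_Mapping.lookup f v
     then coeff F (Poly_Mapping.map (\<lambda>e. e div r) f) else 0)"

definition E_type :: "otype \<Rightarrow> pser" where
  "E_type \<sigma> = (\<Prod>(d, r)\<in>#blocks \<sigma>. subst_power r (E_deg d))"

lemma h_sym_in_PSym_deg:
  assumes "i \<ge> 1"
  shows "h_sym i m \<in> PSym_deg (i * m)"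
proof (rule PSym_degI)
  show "pinvariant (h_sym i m)"
    unfolding pinvariant_def
  proof (intro allI impI)
    fix a j k :: nat and f :: monomial
    assume ajk: "a \<ge> 1" "j \<ge> 1" "k \<ge> 1"
    have "transpose (a, j) (a, k) v \<in> {i} \<times> {1..} \<longleftrightarrow> v \<in> {i} \<times> {1..}" for v
      using ajk by (auto simp: transpose_def)
    then have keys: "Poly_Mapping.keys (Poly_Mapping.map_key (transpose (a, j) (a, k)) f) \<subseteq> {i} \<times> {1..}
        \<longleftrightarrow> Poly_Mapping.keys f \<subseteq> {i} \<times> {1..}"
      unfolding keys_map_key_transpose by blast
    show "coeff (h_sym i m) (Poly_Mapping.map_key (transpose (a, j) (a, k)) f) =
        coeff (h_sym i m) f"
      unfolding h_sym_def pser.sel keys sum_map_key_transpose[where c = "\<lambda>_ e. e"] ..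
  qed
  fix f assume nz: "coeff (h_sym i m) f \<noteq> 0"
  then have f: "Poly_Mapping.keys f \<subseteq> {i} \<times> {1..}"
      "(\<Sum>v\<in>Poly_Mapping.keys f. Poly_Mapping.lookup f v) = m"
    by (auto simp: h_sym_def split: if_splits)
  from f(1) assms show "Poly_Mapping.keys f \<subseteq> xvars"
    by (auto simp: xvars_def)
  have "mdeg f = (\<Sum>v\<in>Poly_Mapping.keys f. i * Poly_Mapping.lookup f v)"
    unfolding mdeg_def using f(1) by (intro sum.cong) auto
  then show "mdeg f = i * m"
    by (simp add: f(2) flip: sum_distrib_left)
qed

lemma mdeg_map_key_transpose:
  "mdeg (Poly_Mapping.map_key (transpose (i, j) (i, k)) f) = mdeg f"
proof -
  have "fst (transpose (i, j) (i, k) v) = fst v" for v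
    by (auto simp: transpose_def)
  then show ?thesis
    by (simp add: mdeg_def sum_map_key_transpose[where c = "\<lambda>v e. fst v * e"])
qed

lemma all_transpose: "(\<forall>x. P (transpose u v x)) \<longleftrightarrow> (\<forall>x. P x)"
proof
  assume P: "\<forall>x. P (transpose u v x)"
  have "P x" for x
    using P[rule_format, of "transpose u v x"] by simp
  then show "\<forall>x. P x" ..
qed simp

lemma E_deg_in_PSym_deg: "E_deg d \<in> PSym_deg d"
proof (rule PSym_degI)
  show "pinvariant (E_deg d)"
    unfolding pinvariant_def
  proof (intro allI impI)
    fix a j k :: nat and f :: monomial
    assume ajk: "a \<ge> 1" "j \<ge> 1" "k \<ge> 1"
    have "transpose (a, j) (a, k) v \<in> xvars \<longleftrightarrow> v \<in> xvars" for v
      using ajk by (auto simp: transpose_def xvars_def)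
    then have keys: "Poly_Mapping.keys (Poly_Mapping.map_key (transpose (a, j) (a, k)) f) \<subseteq> xvars
        \<longleftrightarrow> Poly_Mapping.keys f \<subseteq> xvars"
      unfolding keys_map_key_transpose by blast
    have card: "card (Poly_Mapping.keys (Poly_Mapping.map_key (transpose (a, j) (a, k)) f)) =
        card (Poly_Mapping.keys f)"
      unfolding keys_map_key_transpose by (simp add: card_image)
    show "coeff (E_deg d) (Poly_Mapping.map_key (transpose (a, j) (a, k)) f) =
        coeff (E_deg d) f"
      unfolding E_deg_def pser.sel mdeg_map_key_transpose lookup_map_key_transpose
        all_transpose[of "\<lambda>v. Poly_Mapping.lookup f v \<le> 1"] keys card ..
  qed
qed (auto simp: E_deg_def split: if_splits)

lemma subst_power_in_PSym_deg:
  assumes "F \<in> PSym_deg d" "r \<ge> 1"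
  shows "subst_power r F \<in> PSym_deg (d * r)"
proof (rule PSym_degI)
  let ?q = "Poly_Mapping.map (\<lambda>e. e div r) :: monomial \<Rightarrow> monomial"
  have inv: "pinvariant F"
    using assms by (simp add: PSym_deg_def PSym_def)
  show "pinvariant (subst_power r F)"
    unfolding pinvariant_def
  proof (intro allI impI)
    fix a j k :: nat and f :: monomial
    assume ajk: "a \<ge> 1" "j \<ge> 1" "k \<ge> 1"
    let ?t = "transpose (a, j) (a, k)"
    have "?q (Poly_Mapping.map_key ?t f) = Poly_Mapping.map_key ?t (?q f)"
      by (rule poly_mapping_eqI) (simp add: map.rep_eq lookup_map_key_transpose)
    then have "coeff F (?q (Poly_Mapping.map_key ?t f)) = coeff F (?q f)"
      using inv ajk unfolding pinvariant_def by simp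
    then show "coeff (subst_power r F) (Poly_Mapping.map_key ?t f) = coeff (subst_power r F) f"
      unfolding subst_power_def pser.sel lookup_map_key_transpose
        all_transpose[of "\<lambda>v. r dvd Poly_Mapping.lookup f v"]
      by simp
  qed
  fix f assume "coeff (subst_power r F) f \<noteq> 0"
  then have dvd: "r dvd Poly_Mapping.lookup f v" and nz: "coeff F (?q f) \<noteq> 0" for v
    by (auto simp: subst_power_def simp del: split_paired_All split: if_splits)
  have lookup: "Poly_Mapping.lookup f v = r * Poly_Mapping.lookup (?q f) v" for v
    using dvd[of v] by (simp add: map.rep_eq when_def)
  have keys: "Poly_Mapping.keys f = Poly_Mapping.keys (?q f)"
    using assms(2) by (auto simp: in_keys_iff lookup)
  show "Poly_Mapping.keys f \<subseteq> xvars"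
    using PSym_degD(1)[OF assms(1) nz] keys by simp
  have "mdeg f = r * mdeg (?q f)"
    unfolding mdeg_def keys by (simp add: lookup sum_distrib_left mult_ac)
  then show "mdeg f = d * r"
    using PSym_degD(2)[OF assms(1) nz] by simp
qed

lemma h_tensor_in_PSym_deg:
  assumes "\<delta> \<in> OTyp n"
  shows "h_tensor \<delta> \<in> PSym_deg n"
proof -
  have list: "prod_list (map (h_sym i) ms) \<in> PSym_deg (i * sum_list ms)" if "i \<ge> 1" for i ms
    by (induction ms)
      (auto simp: distrib_left intro: PSym_deg_one PSym_deg_times h_sym_in_PSym_deg[OF that])
  have "i \<ge> 1" if "\<delta> i \<noteq> []" for i
    using assms that by (cases i) (auto simp: OTyp_def is_otype_def)
  then have "h_tensor \<delta> \<in> PSym_deg (otype_weight \<delta>)"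
    unfolding h_tensor_def otype_weight_def using assms
    by (intro PSym_deg_prod list) (auto simp: OTyp_def is_otype_def)
  then show ?thesis using assms by (simp add: OTyp_def)
qed

lemma E_type_in_PSym_deg:
  assumes "\<sigma> \<in> OTyp n"
  shows "E_type \<sigma> \<in> PSym_deg n"
proof -
  have fin: "finite {d. \<sigma> d \<noteq> []}"
    using assms by (auto simp: OTyp_def is_otype_def)
  have pos: "r \<ge> 1" if "(d, r) \<in># blocks \<sigma>" for d r
    using that assms fin by (auto simp: blocks_def OTyp_def is_otype_def set_mset_sum)
  have "E_type \<sigma> \<in> PSym_deg (\<Sum>(d, r)\<in>#blocks \<sigma>. d * r)"
    unfolding E_type_def
    by (intro PSym_deg_prod_mset) (auto intro: subst_power_in_PSym_deg E_deg_in_PSym_deg pos)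
  also have "(\<Sum>(d, r)\<in>#blocks \<sigma>. d * r) = otype_weight \<sigma>"
  proof -
    have "(\<Sum>(d, r)\<in>#(\<Sum>d\<in>A. image_mset (Pair d) (mset (\<sigma> d))). d * r) =
        (\<Sum>d\<in>A. d * sum_list (\<sigma> d))" if "finite A" for A
      using that
    proof (induction A rule: finite_induct)
      case (insert d A)
      have "(\<Sum>r\<in>#mset ms. d * r) = d * sum_list ms" for ms
        by (induction ms) (auto simp: distrib_left)
      with insert show ?case by (simp add: image_mset.compositionality comp_def)
    qed simp
    then show ?thesis using fin by (simp add: blocks_def otype_weight_def)
  qed
  finally show ?thesis using assms by (simp add: OTyp_def)
qed

text \<open>
  The coefficient of \<open>h\<^sup>\<otimes>\<^sub>\<tau>\<close> in the expansion of \<open>F \<in> PSym(n)\<close> in the basis of \<open>PSym(n)\<close> formed by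
  the \<open>h\<^sup>\<otimes>\<close> of the types of \<open>n\<close>.
\<close>

definition h_coeff :: "nat \<Rightarrow> pser \<Rightarrow> otype \<Rightarrow> rat" where
  "h_coeff n F \<tau> = pser.representation (h_tensor ` Typ n) F (h_tensor \<tau>)"


section \<open>The function \<open>s\<close>-hat\<close>

definition shat_word :: "nat \<Rightarrow> nat list \<Rightarrow> int" where
  "shat_word r w = (let v = (\<lambda>i. (w ! i + i) mod r) in
     if inj_on v {..<r} then (-1) ^ card {(i, j). i < j \<and> j < r \<and> v i > v j} else 0)"

definition shat :: "nat \<Rightarrow> nat list \<Rightarrow> int" where
  "shat r \<beta> = (if length \<beta> \<le> r
     then (\<Sum>w | length w = r \<and> filter (\<lambda>x. x \<noteq> 0) w = \<beta>. shat_word r w) else 0)"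

text \<open>Restricting the product to nonempty \<open>\<delta>|\<^sub>i\<close> is harmless because \<open>shat r [] = 1\<close>.\<close>

definition shat_otype :: "nat \<Rightarrow> otype \<Rightarrow> int" where
  "shat_otype r \<delta> = (\<Prod>i | \<delta> i \<noteq> []. shat r (\<delta> i))"


section \<open>Labeled polywrappings\<close>

text \<open>
  A box is a pair (row, column), both counted from \<open>0\<close>.  The \<open>k\<close>-sheets of an array with \<open>r\<close>
  columns consist of the rows \<open>q * k, \<dots>, q * k + k - 1\<close>, and the columns of \<open>k\<close>-sheets in
  reading order are \<open>sheet_column r k 0, sheet_column r k 1, \<dots>\<close>.  None of this depends on the
  number of rows \<open>d\<close>, which only bounds the index of the sheet-columns by \<open>d * r div k\<close>.
\<close>

type_synonym box = "nat \<times> nat"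

definition sheet_column :: "nat \<Rightarrow> nat \<Rightarrow> nat \<Rightarrow> box set" where
  "sheet_column r k s = {(s div r) * k ..< (s div r) * k + k} \<times> {s mod r}"

definition wrapping :: "nat \<Rightarrow> nat \<Rightarrow> nat list \<Rightarrow> box set list" where
  "wrapping r k \<beta> = map (\<lambda>j. \<Union>s\<in>{sum_list (take j \<beta>) ..< sum_list (take (Suc j) \<beta>)}.
     sheet_column r k s) [0..<length \<beta>]"

text \<open>
  The polywrapping of ordered content \<open>\<gamma>\<close>, as the function mapping \<open>k\<close> to the list of its
  rectangles of height \<open>k\<close>.  The \<open>k\<close>-th group of rows starts below the groups of all smaller
  indices.
\<close>

definition group_start :: "nat \<Rightarrow> otype \<Rightarrow> nat \<Rightarrow> nat" where
  "group_start r \<gamma> k = (\<Sum>j = 1..<k. j * sum_list (\<gamma> j) div r)"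

definition polywrapping :: "nat \<Rightarrow> otype \<Rightarrow> nat \<Rightarrow> box set list" where
  "polywrapping r \<gamma> k =
     map (\<lambda>B. (\<lambda>(a, c). (group_start r \<gamma> k + a, c)) ` B) (wrapping r k (\<gamma> k))"

record lpw =
  pocon :: otype
  rects :: "nat \<Rightarrow> box set list"
  labels :: "nat \<Rightarrow> nat list"

text \<open>
  The condition on the labels says that they weakly increase and that the values used are
  \<open>1, \<dots>, m\<close> for some \<open>m \<le> r\<close> (with \<open>m = 0\<close> if there is no rectangle of height \<open>k\<close>).
\<close>

definition labeled_polywrappings :: "nat \<Rightarrow> nat \<Rightarrow> lpw set" where
  "labeled_polywrappings d r = {D. pocon D \<in> OTyp_div r (d * r) \<and>
     rects D = polywrapping r (pocon D) \<and>
     (\<forall>k. length (labels D k) = length (rects D k) \<and> sorted (labels D k) \<and>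
          (\<exists>m\<le>r. set (labels D k) = {1..m}))}"

definition labeling_otype :: "lpw \<Rightarrow> otype" where
  "labeling_otype D = (\<lambda>k.
     map (\<lambda>i. (\<Sum>j | j < length (rects D k) \<and> labels D k ! j = i. card (rects D k ! j)) div k)
         [1..<Suc (card (set (labels D k)))])"

definition lpw_sgn :: "nat \<Rightarrow> lpw \<Rightarrow> int" where
  "lpw_sgn r D =
     (-1) ^ (otype_area (pocon D) - otype_length (pocon D)) * shat_otype r (labeling_otype D)"


section \<open>Labeled polywrapping block tabloids\<close>

text \<open>The shape is given by a list of blocks.\<close>

definition tabloids :: "(nat \<times> nat) list \<Rightarrow> otype \<Rightarrow> lpw list set" where
  "tabloids bs \<tau> = {T. list_all2 (\<lambda>(d, r) D. D \<in> labeled_polywrappings d r) bs T \<and>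
     sum_list (map (\<lambda>D. blocks (psort (pocon D))) T) = blocks \<tau>}"

definition tabloid_sgn :: "(nat \<times> nat) list \<Rightarrow> lpw list \<Rightarrow> int" where
  "tabloid_sgn bs T = prod_list (map2 (\<lambda>(d, r) D. lpw_sgn r D) bs T)"

end

theory Submission
  imports
    "Jordan_Normal_Form.Determinant"
    "HOL-Computational_Algebra.Formal_Power_Series"
    "HOL-Library.Product_Lexorder"
    Defs
begin

text \<open>
  Fix a row \<open>i\<close> of variables and put \<open>E(u) = \<Prod>\<^sub>j (1 - x\<^sub>i\<^sub>j u)\<close>.  Splitting \<open>E\<close> by exponents modulo
  \<open>r\<close> gives the circulant matrix \<open>E(u P)\<close>, where \<open>P\<close> is the \<open>r \<times> r\<close> cyclic shift.  The Leibniz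
  expansion of its determinant is the generating function of the products of the coefficients of
  \<open>E\<close> along \<open>r\<close>-tuples \<open>w\<close>, weighted by \<open>shat_word r w\<close>.  On the other hand \<open>F \<mapsto> det F(u P)\<close> is
  multiplicative and \<open>det (1 - x u P) = 1 - (x u)\<^sup>r\<close>, so the determinant is \<open>\<Prod>\<^sub>j (1 - (x\<^sub>i\<^sub>j u)\<^sup>r)\<close>; the
  product of these series over all rows generates the \<open>E\<close> of the blocks \<open>d\<^sup>r\<close>.  Inverting
  \<open>E(u) H(u) = 1\<close> replaces each coefficient of \<open>E\<close> by a signed sum of products of \<open>h\<close>'s over
  compositions; these compositions, concatenated, are the ordered contents, and the labels remember
  where one composition ends and the next begins.

  The \<open>h\<^sup>\<otimes>\<^sub>\<tau>\<close> of the types of \<open>n\<close> are linearly independent because they span the corresponding products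
  of coefficients of the \<open>E(u)\<close>, which are equally many and have distinct lexicographically leading
  monomials.
\<close>

hide_const (open) Polynomial.coeff

section \<open>Circulant determinants\<close>

lemma card_inversions_transpose:
  fixes a b n :: nat
  assumes "a < b" "b < n"
  shows "odd (card {(i, j). i < j \<and> j < n \<and> transpose a b i > transpose a b j})"
proof -
  \<comment> \<open>Besides \<open>(a, b)\<close> itself, each \<open>k\<close> strictly between
    \<open>a\<close> and \<open>b\<close> gives the two inversions \<open>(a, k)\<close> and
    \<open>(k, b)\<close>, hence an odd total.\<close>
  have "{(i, j). i < j \<and> j < n \<and> transpose a b i > transpose a b j} =
      insert (a, b) (Pair a ` {a<..<b} \<union> (\<lambda>k. (k, b)) ` {a<..<b})"
    using assms by (auto simp: transpose_def split: if_splits)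
  moreover have "card (Pair a ` {a<..<b} \<union> (\<lambda>k. (k, b)) ` {a<..<b}) = 2 * card {a<..<b}"
    by (subst card_Un_disjoint) (auto simp: card_image inj_on_def)
  moreover have "(a, b) \<notin> Pair a ` {a<..<b} \<union> (\<lambda>k. (k, b)) ` {a<..<b}" by auto
  ultimately show ?thesis by simp
qed

text \<open>The sign in the form in which it occurs in \<open>shat_word\<close>. It makes sense for
  any map, not only for permutations; on permutations it is matched with \<open>sign\<close>, the
  sign in the Leibniz formula.\<close>

definition inv_sign :: "nat \<Rightarrow> (nat \<Rightarrow> nat) \<Rightarrow> int" where
  "inv_sign n p = (-1) ^ card {(i, j). i < j \<and> j < n \<and> p i > p j}"

lemma inv_sign_id: "inv_sign n id = 1"
proof -
  have "{(i, j). i < j \<and> j < n \<and> id i > (id j :: nat)} = {}" by auto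
  then show ?thesis by (simp only: inv_sign_def card.empty power_0)
qed

lemma inv_sign_prod:
  "inv_sign n p = (\<Prod>(i, j)\<in>{(i, j). i < j \<and> j < n}. if p j < p i then -1 else 1)"
proof -
  have fin: "finite {(i, j). i < j \<and> j < (n::nat)}"
    by (rule finite_subset[of _ "{..<n} \<times> {..<n}"]) auto
  have "(\<Prod>(i, j)\<in>{(i, j). i < j \<and> j < n}. if p j < p i then -1 else 1) =
      (\<Prod>x\<in>{(i, j). i < j \<and> j < n}. if x \<in> {(i, j). p j < p i} then -1 else (1::int))"
    by (intro prod.cong) auto
  also have "\<dots> = (\<Prod>x\<in>{(i, j). i < j \<and> j < n} \<inter> {(i, j). p j < p i}. -1)"
    using fin by (subst prod.inter_restrict) auto
  also have "\<dots> = inv_sign n p"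
    unfolding inv_sign_def prod_constant by (intro arg_cong[where f = "\<lambda>A. (-1) ^ card A"]) auto
  finally show ?thesis by simp
qed

text \<open>Whether \<open>q \<circ> p\<close> inverts a pair is decided by whether \<open>p\<close>
  inverts it and whether \<open>q\<close> inverts its image. Since \<open>p\<close> permutes the
  unordered pairs, the product of the factors of \<open>q\<close> over all images is the sign of
  \<open>q\<close>.\<close>

lemma inv_sign_comp:
  assumes p: "p permutes {..<n}" and q: "q permutes {..<n}"
  shows "inv_sign n (q \<circ> p) = inv_sign n q * inv_sign n p"
proof -
  let ?P = "{(i, j). i < j \<and> j < n}"
  \<comment> \<open>The factor of \<open>q\<close> at a pair is written symmetrically in its two
    entries, so that the image of a pair under \<open>p\<close> may be put in increasing order by
    \<open>?m p\<close>.\<close>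
  let ?t = "\<lambda>(a, b). if (a < b) = (q a < q b) then 1 else (-1 :: int)"
  let ?m = "\<lambda>f (i, j). (min (f i) (f j), max (f i) (f j :: nat))"
  obtain p' where p': "p' permutes {..<n}" "\<And>x. p' (p x) = x" "\<And>x. p (p' x) = x"
    using permutes_inv[OF p] permutes_inverses[OF p] by metis
  have inj: "inj p" "inj q" using p q by (auto intro: permutes_inj)
  have t: "(if (q \<circ> p) j < (q \<circ> p) i then -1 else 1) =
      ?t (p i, p j) * (if p j < p i then -1 else 1)" if "i < j" for i j
  proof -
    have "p i \<noteq> p j" "q (p i) \<noteq> q (p j)" using inj that by (auto dest: injD)
    then show ?thesis by auto
  qed
  have "inv_sign n (q \<circ> p) = (\<Prod>(i, j)\<in>?P. ?t (p i, p j)) * inv_sign n p"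
    unfolding inv_sign_prod prod.distrib[symmetric]
    by (intro prod.cong refl) (use t in auto)
  also have "(\<Prod>(i, j)\<in>?P. ?t (p i, p j)) = (\<Prod>x\<in>?P. ?t (?m p x))"
  proof (rule prod.cong)
    fix x assume "x \<in> ?P"
    then obtain i j where x: "x = (i, j)" "i < j" by auto
    then have "p i \<noteq> p j" "q (p i) \<noteq> q (p j)" using inj by (auto dest: injD)
    then show "(case x of (i, j) \<Rightarrow> ?t (p i, p j)) = ?t (?m p x)"
      unfolding x(1) by (auto simp: min_def max_def)
  qed simp
  also have "\<dots> = (\<Prod>x\<in>?P. ?t x)"
  \<comment> \<open>The inverse of \<open>?m p\<close> on increasing pairs is \<open>?m p'\<close>,
    with \<open>p'\<close> the inverse permutation.\<close>
  proof (rule prod.reindex_bij_betw, rule bij_betw_byWitness)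
    have maps: "?m f ` ?P \<subseteq> ?P" if f: "f permutes {..<n}" for f
    proof (rule image_subsetI)
      fix x assume "x \<in> ?P"
      then obtain i j where x: "x = (i, j)" "i < j" "j < n" by auto
      then have "f i < n" "f j < n" "f i \<noteq> f j"
        using permutes_in_image[OF f] permutes_inj[OF f] by (force dest: injD)+
      then show "?m f x \<in> ?P" by (simp add: x(1))
    qed
    show "?m p ` ?P \<subseteq> ?P" "?m p' ` ?P \<subseteq> ?P"
      using maps p p'(1) by blast+
    show "\<forall>x\<in>?P. ?m p' (?m p x) = x" "\<forall>x\<in>?P. ?m p (?m p' x) = x"
      using p'(2,3) by (auto simp: min_def max_def)
  qed
  also have "\<dots> = inv_sign n q"
    unfolding inv_sign_prod
  proof (rule prod.cong)
    fix x assume "x \<in> ?P"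
    then obtain i j where x: "x = (i, j)" "i < j" by auto
    then have "q i \<noteq> q j" using inj by (auto dest: injD)
    then show "?t x = (case x of (i, j) \<Rightarrow> if q j < q i then -1 else 1)"
      using x by auto
  qed simp
  finally show ?thesis .
qed

text \<open>Both signs are multiplicative and equal -1 on transpositions, so they agree by induction
  over a product of transpositions.\<close>

lemma sign_eq_inv_sign:
  assumes "p permutes {..<n}"
  shows "sign p = inv_sign n p"
  using assms finite_lessThan
proof (induction rule: permutes_induct)
  case id
  show ?case unfolding inv_sign_id by (simp only: sign_id)
next
  case (swap a b p)
  have t: "transpose a b permutes {..<n}" using swap by (intro permutes_swap_id) auto
  have *: "inv_sign n (transpose a b) = sign (transpose a b)" if "a \<noteq> b" "a < n" "b < n" for a b
    using that
  proof (induction a b rule: linorder_wlog)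
    case (le a b)
    then have "odd (card {(i, j). i < j \<and> j < n \<and> transpose a b i > transpose a b j})"
      by (intro card_inversions_transpose) auto
    with le show ?case by (simp add: inv_sign_def sign_swap_id)
  next
    case (sym a b)
    then show ?case by (metis transpose_commute)
  qed
  have "permutation p" "permutation (transpose a b)"
    using swap t permutation_permutes by blast+
  then have "sign (transpose a b \<circ> p) = sign (transpose a b) * inv_sign n p"
    using swap by (simp add: sign_compose)
  also have "sign (transpose a b) = inv_sign n (transpose a b)"
    using * swap inv_sign_id by (cases "a = b") (auto simp: inv_sign_id)
  finally show ?case by (simp only: inv_sign_comp[OF \<open>p permutes _\<close> t])
qed

section \<open>Circulant matrices of power series and their determinants\<close>

text \<open>This is the power series evaluated at \<open>X\<close> times the cyclic shift matrix:
  the \<open>n\<close>-th power of the shift has its ones at the positions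
  \<open>(i, (n + i) mod r)\<close>.\<close>

definition circulant :: "nat \<Rightarrow> 'a::comm_ring_1 fps \<Rightarrow> 'a fps mat" where
  "circulant r F = mat r r (\<lambda>(i, j). Abs_fps (\<lambda>n. if (n + i) mod r = j then fps_nth F n else 0))"

lemma circulant_carrier [simp]: "circulant r F \<in> carrier_mat r r"
  by (simp add: circulant_def)

lemma circulant_nth:
  assumes "i < r" "j < r"
  shows "fps_nth (circulant r F $$ (i, j)) n = (if (n + i) mod r = j then fps_nth F n else 0)"
  using assms by (simp add: circulant_def)

lemma circulant_one: "circulant r 1 = 1\<^sub>m r"
proof (rule eq_matI)
  fix i j assume "i < dim_row (1\<^sub>m r :: 'a fps mat)" "j < dim_col (1\<^sub>m r :: 'a fps mat)"
  then show "circulant r (1 :: 'a fps) $$ (i, j) = 1\<^sub>m r $$ (i, j)"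
    by (intro fps_ext) (auto simp: circulant_nth)
qed (auto simp: circulant_def)

text \<open>A pair of exponents \<open>s\<close> and \<open>n - s\<close> passes through exactly one
  intermediate index, \<open>(s + i) mod r\<close>, so the matrix product collapses to the Cauchy
  product.\<close>

lemma circulant_mult: "circulant r (F * G) = circulant r F * circulant r G"
proof (rule eq_matI)
  fix i j assume "i < dim_row (circulant r F * circulant r G)" "j < dim_col (circulant r F * circulant r G)"
  then have ij: "i < r" "j < r" by (auto simp: circulant_def)
  show "circulant r (F * G) $$ (i, j) = (circulant r F * circulant r G) $$ (i, j)"
  proof (rule fps_ext)
    fix n
    let ?f = "fps_nth F" and ?g = "fps_nth G"
    have "(circulant r F * circulant r G) $$ (i, j) =
        (\<Sum>k\<in>{0..<r}. circulant r F $$ (i, k) * circulant r G $$ (k, j))"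
      using ij by (auto simp: scalar_prod_def circulant_def intro!: sum.cong)
    then have "fps_nth ((circulant r F * circulant r G) $$ (i, j)) n =
        (\<Sum>k\<in>{0..<r}. \<Sum>s=0..n. (if (s + i) mod r = k then ?f s else 0) *
           (if (n - s + k) mod r = j then ?g (n - s) else 0))"
      using ij by (simp add: fps_sum_nth fps_mult_nth circulant_nth)
    also have "\<dots> = (\<Sum>s=0..n. \<Sum>k\<in>{0..<r}. (if (s + i) mod r = k then ?f s else 0) *
           (if (n - s + k) mod r = j then ?g (n - s) else 0))"
      by (rule sum.swap)
    also have "\<dots> = (\<Sum>s=0..n. if (n + i) mod r = j then ?f s * ?g (n - s) else 0)"
    proof (rule sum.cong)
      fix s assume s: "s \<in> {0..n}"
      have "(\<Sum>k\<in>{0..<r}. (if (s + i) mod r = k then ?f s else 0) *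
           (if (n - s + k) mod r = j then ?g (n - s) else 0)) =
          (\<Sum>k\<in>{0..<r}. if (s + i) mod r = k then
             ?f s * (if (n - s + k) mod r = j then ?g (n - s) else 0) else 0)"
        by (intro sum.cong) auto
      also have "\<dots> = ?f s * (if (n - s + (s + i) mod r) mod r = j then ?g (n - s) else 0)"
        using ij by (subst sum.delta') auto
      also have "(n - s + (s + i) mod r) mod r = (n + i) mod r"
        using s by (subst mod_add_right_eq) simp
      finally show "(\<Sum>k\<in>{0..<r}. (if (s + i) mod r = k then ?f s else 0) *
           (if (n - s + k) mod r = j then ?g (n - s) else 0)) =
          (if (n + i) mod r = j then ?f s * ?g (n - s) else 0)" by simp
    qed simp
    also have "\<dots> = fps_nth (circulant r (F * G) $$ (i, j)) n"
      using ij by (simp add: circulant_nth fps_mult_nth)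
    finally show "fps_nth (circulant r (F * G) $$ (i, j)) n =
        fps_nth ((circulant r F * circulant r G) $$ (i, j)) n" ..
  qed
qed (auto simp: circulant_def)

text \<open>Laplace expansion along the first column: only the first and the last row have a nonzero
  entry there, and both minors are triangular.\<close>

lemma det_circulant_linear:
  fixes c :: "'a::comm_ring_1"
  assumes "r \<ge> 1"
  shows "det (circulant r (1 - fps_const c * fps_X)) = 1 - (fps_const c * fps_X) ^ r"
proof -
  let ?x = "fps_const c * fps_X"
  let ?M = "circulant r (1 - ?x)"
  have entry: "?M $$ (i, j) = (if i = j then 1 else 0) - (if Suc i mod r = j then ?x else 0)"
    if "i < r" "j < r" for i j
  proof (rule fps_ext)
    fix n :: nat
    have "n = 0 \<or> n = 1 \<or> n \<ge> 2" by linarith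
    then show "fps_nth (?M $$ (i, j)) n =
        fps_nth ((if i = j then 1 else 0) - (if Suc i mod r = j then ?x else 0)) n"
      using that by (auto simp: circulant_nth)
  qed
  obtain l where r: "r = Suc l" using assms by (cases r) auto
  show ?thesis
  \<comment> \<open>For \<open>r = 1\<close> the two nonzero entries of the first column merge into
    the single entry \<open>1 - ?x\<close>, so this case is settled directly.\<close>
  proof (cases "l = 0")
    case True
    then show ?thesis using det_single[of ?M] entry[of 0 0] circulant_carrier[of r "1 - ?x"] r by simp
  next
    case False
    \<comment> \<open>The two minors of the expansion: \<open>A\<close> is upper triangular with
      ones on the diagonal, \<open>B\<close> is lower triangular with \<open>- ?x\<close> on the
      diagonal.\<close>
    define A where "A = mat_delete ?M 0 0"
    define B where "B = mat_delete ?M l 0"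
    have A: "A \<in> carrier_mat l l" and B: "B \<in> carrier_mat l l"
      using mat_delete_carrier[OF circulant_carrier[of r "1 - ?x"]] r by (auto simp: A_def B_def)
    have dim: "dim_row ?M = r" "dim_col ?M = r" by (auto simp: circulant_def)
    have Aij: "A $$ (i, j) = (if i = j then 1 else 0) - (if Suc i = j then ?x else 0)"
      if "i < l" "j < l" for i j
    proof -
      have "A $$ (i, j) = ?M $$ (Suc i, Suc j)"
        using that by (simp add: A_def mat_delete_def dim[unfolded r] r)
      then show ?thesis using that by (auto simp: entry[unfolded r] r mod_Suc)
    qed
    have Bij: "B $$ (i, j) = (if i = Suc j then 1 else 0) - (if i = j then ?x else 0)"
      if "i < l" "j < l" for i j
    proof -
      have "B $$ (i, j) = ?M $$ (i, Suc j)"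
        using that by (simp add: B_def mat_delete_def dim[unfolded r] r)
      then show ?thesis using that by (auto simp: entry[unfolded r] r mod_Suc)
    qed
    have "upper_triangular A" using A Aij by (auto simp: upper_triangular_def)
    then have "det A = prod_list (diag_mat A)" by (rule det_upper_triangular[OF _ A])
    also have "diag_mat A = map (\<lambda>i. 1) [0..<l]"
      using A by (auto simp: diag_mat_def Aij)
    finally have detA: "det A = 1" by (simp add: map_replicate_const)
    have "det B = prod_list (diag_mat B)" by (rule det_lower_triangular[OF _ B]) (simp add: Bij)
    also have "diag_mat B = map (\<lambda>i. - ?x) [0..<l]"
      using B by (auto simp: diag_mat_def Bij)
    finally have detB: "det B = (- ?x) ^ l" by (simp add: map_replicate_const)
    have "det ?M = (\<Sum>i<r. ?M $$ (i, 0) * cofactor ?M i 0)"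
      using assms by (intro laplace_expansion_column) auto
    also have "\<dots> = (\<Sum>i\<in>{0, l}. ?M $$ (i, 0) * cofactor ?M i 0)"
    proof (rule sum.mono_neutral_right)
      show "\<forall>i\<in>{..<r} - {0, l}. ?M $$ (i, 0) * cofactor ?M i 0 = 0"
        using entry[of _ 0] r by (auto simp: mod_Suc)
    qed (use r in auto)
    also have "\<dots> = 1 - ?x * ((-1) ^ l * (- ?x) ^ l)"
    proof -
      have "?M $$ (0, 0) = 1" "?M $$ (l, 0) = - ?x"
        using entry[of 0 0] entry[of l 0] False r by auto
      moreover have "cofactor ?M 0 0 = 1" "cofactor ?M l 0 = (-1) ^ l * (- ?x) ^ l"
        by (auto simp: cofactor_def detA detB simp flip: A_def B_def)
      ultimately show ?thesis using False by simp
    qed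
    also have "(-1) ^ l * (- ?x) ^ l = ?x ^ l"
      by (simp flip: power_mult_distrib)
    finally show ?thesis by (simp add: r)
  qed
qed

lemma det_circulant_prod:
  fixes c :: "'b \<Rightarrow> 'a::comm_ring_1"
  assumes "r \<ge> 1" "finite V"
  shows "det (circulant r (\<Prod>v\<in>V. 1 - fps_const (c v) * fps_X)) =
    (\<Prod>v\<in>V. 1 - (fps_const (c v) * fps_X) ^ r)"
  using assms(2)
  by (induction V rule: finite_induct)
    (simp_all add: circulant_one circulant_mult det_mult[of _ r] det_circulant_linear[OF assms(1)])

lemma fps_prod_nth_natpermute:
  fixes a :: "nat \<Rightarrow> 'a::comm_ring_1 fps"
  shows "fps_nth (\<Prod>i<r. a i) N = (\<Sum>w\<in>natpermute N r. \<Prod>i<r. fps_nth (a i) (w ! i))"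
proof (cases r)
  case (Suc m)
  then have "{..<r} = {0..m}" by auto
  then show ?thesis using fps_prod_nth[of a m N] Suc by simp
qed (simp add: natpermute_0)

text \<open>In the Leibniz formula, choosing from row \<open>i\<close> the term of exponent
  \<open>w ! i\<close> forces the column \<open>(w ! i + i) mod r\<close>. A word therefore
  contributes through at most one permutation, whose sign is \<open>shat_word r w\<close>; if the
  forced columns collide, it contributes nothing.\<close>

lemma det_circulant_nth:
  fixes F :: "'a::comm_ring_1 fps"
  shows "fps_nth (det (circulant r F)) N =
    (\<Sum>w\<in>natpermute N r. of_int (shat_word r w) * prod_list (map (fps_nth F) w))"
proof -
  let ?P = "{p. p permutes {..<r}}"
  have finP: "finite ?P" by (intro finite_permutations) auto
  have "det (circulant r F) =
      (\<Sum>p\<in>?P. of_int (sign p) * (\<Prod>i<r. circulant r F $$ (i, p i)))"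
    by (subst det_def'[OF circulant_carrier]) (simp add: lessThan_atLeast0)
  then have "fps_nth (det (circulant r F)) N =
      (\<Sum>p\<in>?P. of_int (sign p) * (\<Sum>w\<in>natpermute N r. \<Prod>i<r. fps_nth (circulant r F $$ (i, p i)) (w ! i)))"
    by (simp add: fps_sum_nth fps_prod_nth_natpermute flip: fps_of_int)
  also have "\<dots> = (\<Sum>w\<in>natpermute N r. \<Sum>p\<in>?P. of_int (sign p) * (\<Prod>i<r. fps_nth (circulant r F $$ (i, p i)) (w ! i)))"
    by (subst sum.swap) (simp add: sum_distrib_left)
  also have "\<dots> = (\<Sum>w\<in>natpermute N r. of_int (shat_word r w) * prod_list (map (fps_nth F) w))"
  proof (rule sum.cong)
    fix w assume "w \<in> natpermute N r"
    then have len: "length w = r" by (simp add: natpermute_def)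
    define v where "v = (\<lambda>i. (w ! i + i) mod r)"
    \<comment> \<open>The forced column map, extended by the identity outside the index range so
      that it can be compared with permutations as functions on all of \<open>nat\<close>.\<close>
    define p0 where "p0 = (\<lambda>i. if i < r then v i else i)"
    let ?\<Pi> = "prod_list (map (fps_nth F) w)"
    have \<Pi>: "(\<Prod>i<r. fps_nth F (w ! i)) = ?\<Pi>"
      by (simp add: prod.list_conv_set_nth len lessThan_atLeast0)
    have prod_eq: "(\<Prod>i<r. fps_nth (circulant r F $$ (i, p i)) (w ! i)) = (if p = p0 then ?\<Pi> else 0)"
      if p: "p permutes {..<r}" for p
    proof -
      have lt: "p i < r" if "i < r" for i using permutes_in_image[OF p, of i] that by auto
      have out: "p i = i" if "\<not> i < r" for i using p that by (auto simp: permutes_def)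
      have "(\<Prod>i<r. fps_nth (circulant r F $$ (i, p i)) (w ! i)) =
          (\<Prod>i<r. if v i = p i then fps_nth F (w ! i) else 0)"
        by (intro prod.cong) (auto simp: circulant_nth lt v_def)
      also have "\<dots> = (if p = p0 then ?\<Pi> else 0)"
      proof (cases "p = p0")
        case True
        then show ?thesis unfolding \<Pi>[symmetric] by (auto simp: p0_def intro!: prod.cong)
      next
        case False
        then obtain i where "p i \<noteq> p0 i" by auto
        with out have "i < r" "v i \<noteq> p i" by (auto simp: p0_def split: if_splits)
        with False show ?thesis by (auto intro!: prod_zero)
      qed
      finally show ?thesis .
    qed
    have "(\<Sum>p\<in>?P. of_int (sign p) * (\<Prod>i<r. fps_nth (circulant r F $$ (i, p i)) (w ! i))) =
        (\<Sum>p\<in>?P. if p = p0 then of_int (sign p) * ?\<Pi> else 0)"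
      by (intro sum.cong) (auto simp: prod_eq)
    also have "\<dots> = (if p0 permutes {..<r} then of_int (sign p0) * ?\<Pi> else 0)"
      using finP by (subst sum.delta) auto
    also have "\<dots> = of_int (shat_word r w) * ?\<Pi>"
    proof -
      have inj_eq: "inj_on p0 {..<r} \<longleftrightarrow> inj_on v {..<r}"
        by (rule inj_on_cong) (simp add: p0_def)
      have "p0 permutes {..<r} \<longleftrightarrow> inj_on v {..<r}"
      proof
        assume "p0 permutes {..<r}"
        then show "inj_on v {..<r}" using inj_eq inj_on_subset permutes_inj by blast
      next
        assume inj: "inj_on v {..<r}"
        have "p0 ` {..<r} \<subseteq> {..<r}" by (auto simp: v_def p0_def)
        then have "p0 ` {..<r} = {..<r}" using inj inj_eq by (intro endo_inj_surj) simp_all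
        then have "bij_betw p0 {..<r} {..<r}" using inj inj_eq by (simp add: bij_betw_def)
        then show "p0 permutes {..<r}" by (rule bij_imp_permutes) (simp add: p0_def)
      qed
      moreover have "inv_sign r p0 = (-1) ^ card {(i, j). i < j \<and> j < r \<and> v i > v j}"
        unfolding inv_sign_def
        by (intro arg_cong[where f = "\<lambda>A. (-1) ^ card A"]) (auto simp: p0_def)
      ultimately show ?thesis
        using sign_eq_inv_sign[of p0 r] by (simp add: shat_word_def Let_def flip: v_def)
    qed
    finally show "(\<Sum>p\<in>?P. of_int (sign p) * (\<Prod>i<r. fps_nth (circulant r F $$ (i, p i)) (w ! i))) =
        of_int (shat_word r w) * ?\<Pi>" .
  qed simp
  finally show ?thesis .
qed

section \<open>Labeled compositions\<close>

text \<open>Distributivity: multiplying out means choosing one summand per list entry. It is applied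
  to the groups of a composition and later to the blocks of a shape.\<close>

lemma sum_list_all2_prod_list:
  fixes f :: "'b \<Rightarrow> 'c \<Rightarrow> 'a::comm_semiring_1"
  assumes "\<And>b. b \<in> set bs \<Longrightarrow> finite (A b)"
  shows "finite {T. list_all2 (\<lambda>b x. x \<in> A b) bs T} \<and>
    (\<Sum>T | list_all2 (\<lambda>b x. x \<in> A b) bs T. prod_list (map2 f bs T)) =
    prod_list (map (\<lambda>b. \<Sum>x\<in>A b. f b x) bs)"
  using assms
proof (induction bs)
  case (Cons b bs)
  let ?S = "{T. list_all2 (\<lambda>b x. x \<in> A b) bs T}"
  have eq: "{T. list_all2 (\<lambda>b x. x \<in> A b) (b # bs) T} = (\<lambda>(x, T). x # T) ` (A b \<times> ?S)"
    by (auto simp: list_all2_Cons1)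
  have inj: "inj_on (\<lambda>(x, T). x # T) (A b \<times> ?S)" by (auto simp: inj_on_def)
  have fin: "finite (A b)" "finite ?S" using Cons by auto
  have "(\<Sum>T | list_all2 (\<lambda>b x. x \<in> A b) (b # bs) T. prod_list (map2 f (b # bs) T)) =
      (\<Sum>(x, T)\<in>A b \<times> ?S. f b x * prod_list (map2 f bs T))"
    unfolding eq by (subst sum.reindex[OF inj]) (auto intro!: sum.cong)
  also have "\<dots> = (\<Sum>x\<in>A b. f b x) * (\<Sum>T\<in>?S. prod_list (map2 f bs T))"
    by (simp add: sum_product sum.cartesian_product)
  finally show ?case using Cons fin by (auto simp: eq)
next
  case Nil
  have "{T. list_all2 (\<lambda>b x. x \<in> A b) [] T} = {[]}" by auto
  then show ?case by simp
qed

lemmas finite_list_all2 = sum_list_all2_prod_list[THEN conjunct1]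
lemmas sum_list_all2_prod = sum_list_all2_prod_list[THEN conjunct2]

section \<open>Compositions and the inversion of power series\<close>

definition comps :: "nat \<Rightarrow> nat list set" where
  "comps n = {\<beta>. 0 \<notin> set \<beta> \<and> sum_list \<beta> = n}"

lemma length_le_sum_list: "0 \<notin> set \<beta> \<Longrightarrow> length \<beta> \<le> sum_list (\<beta> :: nat list)"
  by (induction \<beta>) auto

lemma sum_list_concat_nat: "sum_list (concat G) = sum_list (map sum_list G :: nat list)"
  by (induction G) auto

lemma finite_comps: "finite (comps n)"
proof (rule finite_subset)
  show "comps n \<subseteq> {\<beta>. set \<beta> \<subseteq> {..n} \<and> length \<beta> \<le> n}"
    using length_le_sum_list member_le_sum_list by (fastforce simp: comps_def)
qed (rule finite_lists_length_le, simp)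

lemma comps_0: "comps 0 = {[]}"
  by (auto simp: comps_def) (metis list.set_intros(1) neq_Nil_conv)

lemma comps_pos:
  assumes "n > 0"
  shows "comps n = (\<Union>k\<in>{1..n}. (#) k ` comps (n - k))"
proof (intro equalityI subsetI)
  fix \<beta> assume "\<beta> \<in> comps n"
  then obtain k \<beta>' where "\<beta> = k # \<beta>'" "k \<in> {1..n}" "\<beta>' \<in> comps (n - k)"
    using assms by (cases \<beta>) (auto simp: comps_def)
  then show "\<beta> \<in> (\<Union>k\<in>{1..n}. (#) k ` comps (n - k))" by blast
qed (auto simp: comps_def)

text \<open>The hypotheses say that \<open>b\<close> and \<open>h\<close> are the coefficients of
  mutually inverse series. The recursion for \<open>b n\<close> splits off the first part of a
  composition.\<close>

lemma inverse_series_comps: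
  fixes b h :: "nat \<Rightarrow> 'a::comm_ring_1"
  assumes "b 0 = 1" "h 0 = 1" and conv: "\<And>n. n > 0 \<Longrightarrow> (\<Sum>k\<le>n. h k * b (n - k)) = 0"
  shows "b n = (\<Sum>\<beta>\<in>comps n. prod_list (map (\<lambda>k. - h k) \<beta>))"
proof (induction n rule: less_induct)
  case (less n)
  show ?case
  proof (cases "n = 0")
    case False
    have "(\<Sum>\<beta>\<in>comps n. prod_list (map (\<lambda>k. - h k) \<beta>)) =
        (\<Sum>k\<in>{1..n}. \<Sum>\<beta>\<in>comps (n - k). - h k * prod_list (map (\<lambda>k. - h k) \<beta>))"
      unfolding comps_pos[OF False[unfolded neq0_conv]]
      by (subst sum.UNION_disjoint) (auto simp: finite_comps sum.reindex)
    also have "\<dots> = (\<Sum>k\<in>{1..n}. - (h k * b (n - k)))"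
      by (intro sum.cong refl) (simp add: less.IH sum_distrib_left sum_negf)
    also have "\<dots> = - (\<Sum>k\<in>{1..n}. h k * b (n - k))"
      by (rule sum_negf)
    also have "(\<Sum>k\<in>{1..n}. h k * b (n - k)) = (\<Sum>k\<le>n. h k * b (n - k)) - h 0 * b n"
    proof -
      have "{..n} = insert 0 {1..n}" by auto
      then show ?thesis by simp
    qed
    finally show ?thesis using conv[of n] False assms by simp
  qed (simp add: comps_0 assms)
qed

text \<open>Words are grouped by what is left after deleting their zeros; \<open>b 0 = 1\<close>
  makes the zeros invisible in the product, and the grouped signs add up to
  \<open>shat\<close>.\<close>

lemma sum_shat_comps:
  fixes b :: "nat \<Rightarrow> 'a::comm_ring_1"
  assumes "b 0 = 1"
  shows "(\<Sum>\<delta> | \<delta> \<in> comps N \<and> length \<delta> \<le> r. of_int (shat r \<delta>) * prod_list (map b \<delta>)) =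
    (\<Sum>w\<in>natpermute N r. of_int (shat_word r w) * prod_list (map b w))"
proof -
  let ?g = "filter (\<lambda>x. x \<noteq> (0::nat))"
  have fil: "sum_list (?g w) = sum_list w" "prod_list (map b (?g w)) = prod_list (map b w)" for w
    using assms by (induction w) auto
  have "(\<Sum>w\<in>natpermute N r. of_int (shat_word r w) * prod_list (map b w)) =
     (\<Sum>\<delta> | \<delta> \<in> comps N \<and> length \<delta> \<le> r.
        \<Sum>w | w \<in> natpermute N r \<and> ?g w = \<delta>. of_int (shat_word r w) * prod_list (map b w))"
  proof (rule sum.group[symmetric])
    show "?g ` natpermute N r \<subseteq> {\<delta> \<in> comps N. length \<delta> \<le> r}"
      using fil(1) by (auto simp: comps_def natpermute_def)
  qed (auto simp: natpermute_finite finite_comps)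
  also have "\<dots> = (\<Sum>\<delta> | \<delta> \<in> comps N \<and> length \<delta> \<le> r. of_int (shat r \<delta>) * prod_list (map b \<delta>))"
  proof (rule sum.cong)
    fix \<delta> assume \<delta>: "\<delta> \<in> {\<delta>. \<delta> \<in> comps N \<and> length \<delta> \<le> r}"
    have "{w. w \<in> natpermute N r \<and> ?g w = \<delta>} = {w. length w = r \<and> ?g w = \<delta>}"
      using \<delta> fil(1) by (auto simp: comps_def natpermute_def)
    moreover have "(\<Sum>w | length w = r \<and> ?g w = \<delta>. of_int (shat_word r w) * prod_list (map b w)) =
        (\<Sum>w | length w = r \<and> ?g w = \<delta>. of_int (shat_word r w) * prod_list (map b \<delta>))"
    proof (rule sum.cong)
      fix w assume "w \<in> {w. length w = r \<and> ?g w = \<delta>}"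
      then have "?g w = \<delta>" by blast
      then show "of_int (shat_word r w) * prod_list (map b w) = of_int (shat_word r w) * prod_list (map b \<delta>)"
        using fil(2)[of w] by (simp only:)
    qed simp
    ultimately show "(\<Sum>w | w \<in> natpermute N r \<and> ?g w = \<delta>. of_int (shat_word r w) * prod_list (map b w)) =
        of_int (shat r \<delta>) * prod_list (map b \<delta>)"
      using \<delta> by (simp add: shat_def sum_distrib_right)
  qed simp
  finally show ?thesis ..
qed

section \<open>Labelings as cuts of a composition into groups\<close>

text \<open>All the choices in a labeled polywrapping at a single height: the sizes of the
  rectangles in order, and their labels. The boxes themselves are determined by the ordered
  content.\<close>

definition lcomps :: "nat \<Rightarrow> nat \<Rightarrow> (nat list \<times> nat list) set" where
  "lcomps r N = {(\<beta>, L). \<beta> \<in> comps N \<and> length L = length \<beta> \<and> sorted L \<and> (\<exists>m\<le>r. set L = {1..m})}"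

text \<open>The entry of the ordered type of the labeling at one height, computed from the parts
  instead of from box counts; \<open>labeling_otype_eq\<close> justifies this.\<close>

definition label_sums :: "nat list \<Rightarrow> nat list \<Rightarrow> nat list" where
  "label_sums \<beta> L = map (\<lambda>i. \<Sum>j | j < length \<beta> \<and> L ! j = i. \<beta> ! j) [1..<Suc (card (set L))]"

lemma finite_lcomps: "finite (lcomps r N)"
proof (rule finite_subset)
  show "lcomps r N \<subseteq> comps N \<times> {L. set L \<subseteq> {1..r} \<and> length L \<le> N}"
  proof (rule subrelI)
    fix \<beta> L assume "(\<beta>, L) \<in> lcomps r N"
    then obtain m where "\<beta> \<in> comps N" "length L = length \<beta>" "m \<le> r" "set L = {1..m}"
      by (auto simp: lcomps_def)
    then show "(\<beta>, L) \<in> comps N \<times> {L. set L \<subseteq> {1..r} \<and> length L \<le> N}"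
      using length_le_sum_list[of \<beta>] by (simp add: comps_def)
  qed
qed (intro finite_cartesian_product finite_comps finite_lists_length_le finite_atLeastAtMost)

text \<open>The labels that mark the members of successive groups by \<open>s\<close>,
  \<open>s + 1\<close> and so on. When no group is empty, every value in the range is used, as the
  condition on labels demands.\<close>

fun run_labels :: "nat \<Rightarrow> nat list list \<Rightarrow> nat list" where
  "run_labels s [] = []"
| "run_labels s (g # G) = replicate (length g) s @ run_labels (Suc s) G"

lemma length_run_labels: "length (run_labels s G) = length (concat G)"
  by (induction G arbitrary: s) auto

lemma set_run_labels: "[] \<notin> set G \<Longrightarrow> set (run_labels s G) = {s..<s + length G}"
  by (induction G arbitrary: s) auto

lemma sorted_run_labels: "[] \<notin> set G \<Longrightarrow> sorted (run_labels s G)"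
  by (induction G arbitrary: s) (auto simp: sorted_append set_run_labels)

text \<open>Collecting the parts that carry each label recovers the groups; this supplies the
  injectivity of passing from groups to labeled compositions.\<close>

lemma groups_run_labels:
  assumes "[] \<notin> set G"
  shows "map (\<lambda>i. map fst (filter (\<lambda>q. snd q = i) (zip (concat G) (run_labels s G)))) [s..<s + length G] = G"
  using assms
proof (induction G arbitrary: s)
  case (Cons g G)
  have zip: "zip (concat (g # G)) (run_labels s (g # G)) =
      map (\<lambda>x. (x, s)) g @ zip (concat G) (run_labels (Suc s) G)"
    by (simp add: zip_append zip_replicate2)
  have "snd q \<noteq> s" if "q \<in> set (zip (concat G) (run_labels (Suc s) G))" for q
  proof -
    have "snd q \<in> set (run_labels (Suc s) G)"
      using that by (metis prod.collapse set_zip_rightD)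
    then show ?thesis using set_run_labels[of G "Suc s"] Cons.prems by auto
  qed
  then have "filter (\<lambda>q. snd q = s) (zip (concat G) (run_labels (Suc s) G)) = []"
    by (auto simp: filter_empty_conv)
  moreover have "[s..<s + length (g # G)] = s # [Suc s..<Suc s + length G]"
    by (simp add: upt_rec)
  moreover have "map (\<lambda>i. map fst (filter (\<lambda>q. snd q = i) (zip (concat (g # G)) (run_labels s (g # G)))))
      [Suc s..<Suc s + length G] = G"
  proof -
    have "map (\<lambda>i. map fst (filter (\<lambda>q. snd q = i) (zip (concat (g # G)) (run_labels s (g # G)))))
        [Suc s..<Suc s + length G] =
      map (\<lambda>i. map fst (filter (\<lambda>q. snd q = i) (zip (concat G) (run_labels (Suc s) G))))
        [Suc s..<Suc s + length G]"
      unfolding zip by (intro map_cong refl) (auto simp: filter_empty_conv)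
    also have "\<dots> = G" by (rule Cons.IH) (use Cons.prems in auto)
    finally show ?thesis .
  qed
  ultimately show ?case unfolding zip by (simp add: comp_def)
qed simp

text \<open>Surjectivity, by induction on the number of labels: weak increase puts all occurrences
  of the least label \<open>s\<close> at the front, and they cut off the first group.\<close>

lemma ex_groups:
  assumes "length L = length \<beta>" "sorted L" "set L = {s..<s + m}"
  shows "\<exists>G. [] \<notin> set G \<and> length G = m \<and> concat G = (\<beta> :: nat list) \<and> run_labels s G = L"
  using assms
proof (induction m arbitrary: s \<beta> L)
  case (Suc m)
  define k where "k = length (takeWhile (\<lambda>x. x = s) L)"
  define L' where "L' = dropWhile (\<lambda>x. x = s) L"
  have L: "L = replicate k s @ L'"
    unfolding k_def L'_def
    by (subst takeWhile_dropWhile_id[symmetric, of L "\<lambda>x. x = s"])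
      (metis (mono_tags) replicate_eqI set_takeWhileD)
  have "s \<in> set L" using Suc.prems by simp
  have sortL': "sorted L'" using Suc.prems L by (simp add: sorted_append)
  have gt: "x > s" if "x \<in> set L'" for x
  proof -
    from that obtain y ys where L': "L' = y # ys" by (cases L') auto
    then have "y \<noteq> s" unfolding L'_def by (metis (mono_tags) dropWhile_eq_Cons_conv)
    moreover have "y \<in> set L" using L L' by simp
    then have "y \<ge> s" using Suc.prems by simp
    moreover have "y \<le> x" using that sortL' L' by auto
    ultimately show ?thesis by simp
  qed
  have "k > 0"
    using \<open>s \<in> set L\<close> gt L by (cases k) auto
  have "set L' = {Suc s..<Suc s + m}"
  proof -
    have "set L' = set L - {s}" using L gt by auto
    also have "\<dots> = {Suc s..<Suc s + m}" unfolding Suc.prems(3) by auto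
    finally show ?thesis .
  qed
  moreover have "length L' = length (drop k \<beta>)" using Suc.prems(1) L by auto
  ultimately obtain G where G: "[] \<notin> set G" "length G = m" "concat G = drop k \<beta>" "run_labels (Suc s) G = L'"
    using Suc.IH[of L' "drop k \<beta>" "Suc s"] sortL' by blast
  have len: "length (take k \<beta>) = k" using Suc.prems(1) L by auto
  have "[] \<notin> set (take k \<beta> # G)" "concat (take k \<beta> # G) = \<beta>" "run_labels s (take k \<beta> # G) = L"
    using G len \<open>k > 0\<close> L by auto
  then show ?case using G(2) by (metis length_Cons)
qed auto

lemma label_sums_run_labels:
  assumes "[] \<notin> set G"
  shows "label_sums (concat G) (run_labels 1 G) = map sum_list G"
proof -
  let ?\<beta> = "concat G" and ?L = "run_labels 1 G"
  have len: "length ?L = length ?\<beta>" by (rule length_run_labels)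
  have "(\<Sum>j | j < length ?\<beta> \<and> ?L ! j = i. ?\<beta> ! j) =
      sum_list (map fst (filter (\<lambda>q. snd q = i) (zip ?\<beta> ?L)))" for i
  proof -
    have "sum_list (map fst (filter (\<lambda>q. snd q = i) (zip ?\<beta> ?L))) =
        sum_list (map (\<lambda>q. if snd q = i then fst q else 0) (zip ?\<beta> ?L))"
      by (rule sum_list_map_filter')
    also have "\<dots> = (\<Sum>j<length ?\<beta>. if ?L ! j = i then ?\<beta> ! j else 0)"
      by (auto simp: sum_list_sum_nth length_run_labels lessThan_atLeast0 intro!: sum.cong)
    also have "\<dots> = (\<Sum>j\<in>{..<length ?\<beta>} \<inter> {j. ?L ! j = i}. ?\<beta> ! j)"
      by (simp add: sum.inter_restrict)
    also have "{..<length ?\<beta>} \<inter> {j. ?L ! j = i} = {j. j < length ?\<beta> \<and> ?L ! j = i}" by auto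
    finally show ?thesis ..
  qed
  then have "label_sums ?\<beta> ?L = map sum_list (map (\<lambda>i. map fst (filter (\<lambda>q. snd q = i) (zip ?\<beta> ?L)))
      [1..<Suc (card (set ?L))])"
    by (simp add: label_sums_def)
  also have "Suc (card (set ?L)) = 1 + length G"
    by (simp add: set_run_labels[OF assms])
  also note groups_run_labels[OF assms]
  finally show ?thesis .
qed

text \<open>A labeled composition is a list of nonempty groups. Its sign depends only on the group
  sums \<open>\<delta>\<close>, and for fixed \<open>\<delta>\<close> the groups are independent
  compositions of the entries, so the remaining sum factors.\<close>

lemma sum_lcomps:
  fixes a :: "nat \<Rightarrow> 'a::comm_ring_1"
  shows "(\<Sum>(\<beta>, L)\<in>lcomps r N. of_int (shat r (label_sums \<beta> L)) * prod_list (map a \<beta>)) =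
    (\<Sum>\<delta> | \<delta> \<in> comps N \<and> length \<delta> \<le> r. of_int (shat r \<delta>) *
       prod_list (map (\<lambda>n. \<Sum>\<beta>\<in>comps n. prod_list (map a \<beta>)) \<delta>))"
proof -
  let ?S = "{G. [] \<notin> set G \<and> length G \<le> r \<and> concat G \<in> comps N}"
  let ?f = "\<lambda>G. (concat G, run_labels 1 G)"
  have inj: "inj_on ?f ?S"
  proof (rule inj_onI)
    fix G H assume G: "G \<in> ?S" and H: "H \<in> ?S" and eq: "?f G = ?f H"
    \<comment> \<open>The number of distinct labels gives the number of groups, so both lists are
      recovered over the same range of labels.\<close>
    have "card (set (run_labels 1 G)) = length G" "card (set (run_labels 1 H)) = length H"
      using G H by (auto simp: set_run_labels)
    then have "length G = length H" using eq by simp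
    with eq G H groups_run_labels[of G 1] groups_run_labels[of H 1] show "G = H" by auto
  qed
  have img: "?f ` ?S = lcomps r N"
  proof (intro equalityI subsetI)
    fix x assume "x \<in> ?f ` ?S"
    then show "x \<in> lcomps r N"
      by (force simp: lcomps_def length_run_labels sorted_run_labels set_run_labels)
  next
    fix x assume "x \<in> lcomps r N"
    then obtain \<beta> L m where x: "x = (\<beta>, L)" "\<beta> \<in> comps N" "length L = length \<beta>" "sorted L"
      "m \<le> r" "set L = {1..m}" by (auto simp: lcomps_def)
    from x(6) have "set L = {1..<1 + m}" by (simp add: atLeastLessThanSuc_atLeastAtMost)
    from ex_groups[OF x(3,4) this] obtain G
      where "[] \<notin> set G" "length G = m" "concat G = \<beta>" "run_labels 1 G = L" by blast
    then show "x \<in> ?f ` ?S" using x(1,2,5) by (intro image_eqI[of _ _ G]) simp_all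
  qed
  have fin: "finite ?S" using finite_lcomps[of r N] unfolding img[symmetric] by (rule finite_imageD[OF _ inj])
  have "(\<Sum>(\<beta>, L)\<in>lcomps r N. of_int (shat r (label_sums \<beta> L)) * prod_list (map a \<beta>)) =
      (\<Sum>G\<in>?S. of_int (shat r (map sum_list G)) * prod_list (map a (concat G)))"
    unfolding img[symmetric] by (subst sum.reindex[OF inj]) (auto simp: label_sums_run_labels simp del: One_nat_def intro!: sum.cong)
  also have "\<dots> = (\<Sum>\<delta> | \<delta> \<in> comps N \<and> length \<delta> \<le> r. \<Sum>G | G \<in> ?S \<and> map sum_list G = \<delta>.
      of_int (shat r (map sum_list G)) * prod_list (map a (concat G)))"
  proof (rule sum.group[symmetric, OF fin])
    have "sum_list (map sum_list G) = sum_list (concat G)" for G :: "nat list list"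
      by (simp add: sum_list_concat_nat)
    moreover have "0 \<notin> sum_list ` set G" if "[] \<notin> set G" "\<forall>g\<in>set G. 0 \<notin> set g" for G :: "nat list list"
    proof
      assume "0 \<in> sum_list ` set G"
      then obtain g where g: "g \<in> set G" "sum_list g = 0" by auto
      then have "\<forall>x\<in>set g. x = 0" by (simp add: sum_list_eq_0_iff)
      moreover have "g \<noteq> []" using g that(1) by auto
      ultimately show False using that(2) g(1) by (cases g) auto
    qed
    ultimately show "map sum_list ` ?S \<subseteq> {\<delta>. \<delta> \<in> comps N \<and> length \<delta> \<le> r}"
      by (auto simp: comps_def)
  qed (simp add: finite_comps)
  also have "\<dots> = (\<Sum>\<delta> | \<delta> \<in> comps N \<and> length \<delta> \<le> r. of_int (shat r \<delta>) *
       prod_list (map (\<lambda>n. \<Sum>\<beta>\<in>comps n. prod_list (map a \<beta>)) \<delta>))"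
  proof (rule sum.cong)
    fix \<delta> assume \<delta>: "\<delta> \<in> {\<delta>. \<delta> \<in> comps N \<and> length \<delta> \<le> r}"
    let ?T = "{G. list_all2 (\<lambda>n g. g \<in> comps n) \<delta> G}"
    have "{G. G \<in> ?S \<and> map sum_list G = \<delta>} = ?T"
    proof (intro equalityI subsetI CollectI)
      fix G assume "G \<in> {G. G \<in> ?S \<and> map sum_list G = \<delta>}"
      then show "list_all2 (\<lambda>n g. g \<in> comps n) \<delta> G"
        by (auto simp: list_all2_map1 list_all2_same comps_def)
    next
      fix G assume "G \<in> ?T"
      then have G: "list_all2 (\<lambda>n g. g \<in> comps n) \<delta> G" by simp
      then have eq: "map sum_list G = \<delta>"
        by (induction rule: list_all2_induct) (auto simp: comps_def)
      have nz: "0 \<notin> set g" if "g \<in> set G" for g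
        using G that by (auto simp: list_all2_conv_all_nth in_set_conv_nth comps_def)
      \<comment> \<open>An empty group would put a zero into \<open>\<delta>\<close>.\<close>
      have "[] \<notin> set G" using eq \<delta> by (force simp: comps_def image_iff)
      moreover have "sum_list (concat G) = N" using \<delta> eq by (auto simp: sum_list_concat_nat comps_def)
      moreover have "length G \<le> r" using \<delta> eq by auto
      ultimately show "G \<in> ?S \<and> map sum_list G = \<delta>" using eq nz by (auto simp: comps_def)
    qed
    then have "(\<Sum>G | G \<in> ?S \<and> map sum_list G = \<delta>.
        of_int (shat r (map sum_list G)) * prod_list (map a (concat G))) =
        (\<Sum>G | G \<in> ?S \<and> map sum_list G = \<delta>. of_int (shat r \<delta>) * prod_list (map a (concat G)))"
      by (intro sum.cong) auto
    also have "\<dots> = of_int (shat r \<delta>) * (\<Sum>G\<in>?T. prod_list (map a (concat G)))"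
      using \<open>_ = ?T\<close> by (simp add: sum_distrib_left)
    also have "(\<Sum>G\<in>?T. prod_list (map a (concat G))) =
        (\<Sum>G\<in>?T. prod_list (map2 (\<lambda>_ g. prod_list (map a g)) \<delta> G))"
    proof (rule sum.cong)
      fix G assume "G \<in> ?T"
      then have "list_all2 (\<lambda>n g. g \<in> comps n) \<delta> G" by simp
      then show "prod_list (map a (concat G)) = prod_list (map2 (\<lambda>_ g. prod_list (map a g)) \<delta> G)"
        by (induction rule: list_all2_induct) auto
    qed simp
    also have "\<dots> = prod_list (map (\<lambda>n. \<Sum>\<beta>\<in>comps n. prod_list (map a \<beta>)) \<delta>)"
      by (rule sum_list_all2_prod) (rule finite_comps)
    finally show "(\<Sum>G | G \<in> ?S \<and> map sum_list G = \<delta>.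
        of_int (shat r (map sum_list G)) * prod_list (map a (concat G))) =
        of_int (shat r \<delta>) * prod_list (map (\<lambda>n. \<Sum>\<beta>\<in>comps n. prod_list (map a \<beta>)) \<delta>)" .
  qed simp
  finally show ?thesis .
qed

section \<open>Truncation to finitely many variables\<close>

lemma coeff_plus [simp]: "coeff (F + G) f = coeff F f + coeff G f"
  by (simp add: plus_pser_def)

lemma coeff_minus [simp]: "coeff (F - G) f = coeff F f - coeff G f"
  by (simp add: minus_pser_def)

lemma coeff_uminus [simp]: "coeff (- F) f = - coeff F f"
  by (simp add: uminus_pser_def)

lemma coeff_0 [simp]: "coeff 0 f = 0"
  by (simp add: zero_pser_def)

lemma coeff_1: "coeff 1 f = (if f = 0 then 1 else 0)"
  by (simp add: one_pser_def)

lemma coeff_sum: "coeff (sum F A) f = (\<Sum>x\<in>A. coeff (F x) f)"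
  by (induction A rule: infinite_finite_induct) auto

lemma coeff_times: "coeff (F * G) f = (\<Sum>(a, b) \<in> {(a, b). a + b = f}. coeff F a * coeff G b)"
  by (simp add: times_pser_def)

lemma of_int_times_pser: "of_int c * F = pscale (of_int c) F"
proof -
  have nat: "of_nat n * F = pscale (of_nat n) F" for n
    by (induction n) (auto intro!: pser_eqI simp: pscale_def algebra_simps)
  show ?thesis
  proof (cases c rule: int_cases2)
    case (nonneg n)
    then show ?thesis by (simp add: nat)
  next
    case (nonpos n)
    then show ?thesis by (auto simp: nat pscale_def intro!: pser_eqI)
  qed
qed

lemma coeff_of_int_times [simp]: "coeff (of_int c * F) f = of_int c * coeff F f"
  by (simp add: of_int_times_pser pscale_def)

definition monom_ser :: "monomial \<Rightarrow> pser" where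
  "monom_ser g = PSer (\<lambda>f. if f = g then 1 else 0)"

lemma coeff_monom_ser [simp]: "coeff (monom_ser g) f = (if f = g then 1 else 0)"
  by (simp add: monom_ser_def)

lemma coeff_monom_ser_times:
  "coeff (monom_ser g * F) f = (if \<exists>f'. f = g + f' then coeff F (f - g) else 0)"
proof -
  have "coeff (monom_ser g * F) f = (\<Sum>(a, b) | a + b = f. if a = g then coeff F b else 0)"
    by (auto simp: coeff_times intro!: sum.cong)
  also have "\<dots> = (\<Sum>(a, b)\<in>(if \<exists>f'. f = g + f' then {(g, f - g)} else {}). if a = g then coeff F b else 0)"
    by (rule sum.mono_neutral_right) (auto simp: finite_splits split: if_splits)
  finally show ?thesis by auto
qed

lemma monom_ser_0: "monom_ser 0 = 1"
  by (rule pser_eqI) (simp add: coeff_1)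

lemma monom_ser_add: "monom_ser (a + b) = monom_ser a * monom_ser b"
  by (rule pser_eqI) (auto simp: coeff_monom_ser_times)

lemma monom_ser_single_power: "monom_ser (Poly_Mapping.single v 1) ^ n = monom_ser (Poly_Mapping.single v n)"
  by (induction n) (auto simp: monom_ser_0 simp flip: monom_ser_add single_add)

section \<open>Restriction of series to a set of variables\<close>

definition restr :: "(nat \<times> nat) set \<Rightarrow> pser \<Rightarrow> pser" where
  "restr V F = PSer (\<lambda>f. if Poly_Mapping.keys f \<subseteq> V then coeff F f else 0)"

lemma coeff_restr [simp]: "coeff (restr V F) f = (if Poly_Mapping.keys f \<subseteq> V then coeff F f else 0)"
  by (simp add: restr_def)

text \<open>Each monomial involves finitely many variables, so identities may be checked with
  finitely many variables, where the infinite products over a row become finite ones.\<close>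

lemma restr_eqI:
  assumes "\<And>V. finite V \<Longrightarrow> restr V F = restr V G"
  shows "F = G"
proof (rule pser_eqI)
  fix f
  have "coeff (restr (Poly_Mapping.keys f) F) f = coeff (restr (Poly_Mapping.keys f) G) f"
    by (subst assms) auto
  then show "coeff F f = coeff G f" by simp
qed

text \<open>Restriction sets the other variables to zero. It is multiplicative because exponents in
  \<open>nat\<close> cannot cancel: a product of monomials lies in \<open>V\<close> only if both
  factors do.\<close>

lemma restr_times: "restr V (F * G) = restr V F * restr V G"
proof (rule pser_eqI)
  fix f
  show "coeff (restr V (F * G)) f = coeff (restr V F * restr V G) f"
  proof (cases "Poly_Mapping.keys f \<subseteq> V")
    case True
    then show ?thesis by (auto simp: coeff_times keys_add_nat intro!: sum.cong)
  next
    case False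
    then have "coeff (restr V F * restr V G) f = 0"
      unfolding coeff_times by (intro sum.neutral) (auto simp: keys_add_nat)
    with False show ?thesis by simp
  qed
qed

lemma restr_1: "restr V 1 = 1"
  by (rule pser_eqI) (auto simp: coeff_1)

lemma restr_0: "restr V 0 = 0"
  by (rule pser_eqI) auto

lemma restr_sum: "restr V (sum F A) = (\<Sum>x\<in>A. restr V (F x))"
  by (rule pser_eqI) (auto simp: coeff_sum)

lemma restr_of_int_times: "restr V (of_int c * F) = of_int c * restr V F"
  by (rule pser_eqI) auto

lemma restr_prod_list: "restr V (prod_list Fs) = prod_list (map (restr V) Fs)"
  by (induction Fs) (auto simp: restr_times restr_1)

section \<open>Elementary and complete homogeneous series of one row\<close>

text \<open>Unlike \<open>mdeg\<close>, every variable counts once whatever its row; within a row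
  this is the exponent of the formal variable of the generating series.\<close>

definition tdeg :: "monomial \<Rightarrow> nat" where
  "tdeg f = (\<Sum>v\<in>Poly_Mapping.keys f. Poly_Mapping.lookup f v)"

lemma tdeg_eq:
  assumes "finite A" "Poly_Mapping.keys f \<subseteq> A"
  shows "tdeg f = (\<Sum>v\<in>A. Poly_Mapping.lookup f v)"
  unfolding tdeg_def using assms
  by (intro sum.mono_neutral_left) (auto simp: in_keys_iff)

lemma tdeg_add: "tdeg (a + b) = tdeg a + tdeg b"
proof -
  let ?A = "Poly_Mapping.keys a \<union> Poly_Mapping.keys b"
  have "Poly_Mapping.keys (a + b) \<subseteq> ?A" by (rule keys_add)
  then show ?thesis
    by (simp add: tdeg_eq[of ?A] lookup_add sum.distrib)
qed

lemma tdeg_eq_0_iff: "tdeg f = 0 \<longleftrightarrow> f = 0"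
proof
  assume "tdeg f = 0"
  then have "Poly_Mapping.lookup f (i, j) = 0" for i j
    by (cases "(i, j) \<in> Poly_Mapping.keys f") (simp_all add: tdeg_def in_keys_iff)
  then show "f = 0" by (intro poly_mapping_eqI) auto
qed (simp add: tdeg_def)

text \<open>The coefficient of \<open>u\<^sup>r\<^sup>m\<close> in \<open>\<Prod>\<^sub>j (1 - (x\<^sub>i\<^sub>j u)\<^sup>r)\<close>.\<close>

definition e_pow :: "nat \<Rightarrow> nat \<Rightarrow> nat \<Rightarrow> pser" where
  "e_pow r i m = PSer (\<lambda>f. if Poly_Mapping.keys f \<subseteq> {i} \<times> {1..} \<and>
     (\<forall>v\<in>Poly_Mapping.keys f. Poly_Mapping.lookup f v = r) \<and> card (Poly_Mapping.keys f) = m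
     then (-1) ^ m else 0)"

abbreviation xvar :: "nat \<times> nat \<Rightarrow> pser" where
  "xvar v \<equiv> monom_ser (Poly_Mapping.single v 1)"

lemma prod_one_minus:
  fixes a :: "'b \<Rightarrow> 'a::comm_ring_1"
  assumes "finite W"
  shows "(\<Prod>v\<in>W. 1 - a v) = (\<Sum>S\<in>Pow W. (-1) ^ card S * (\<Prod>v\<in>S. a v))"
proof -
  have "(\<Prod>v\<in>W. 1 - a v) = (\<Prod>v\<in>W. - a v + 1)" by simp
  also have "\<dots> = (\<Sum>S\<in>Pow W. (\<Prod>v\<in>S. - a v) * (\<Prod>v\<in>W - S. 1))"
    by (rule prod_add[OF assms])
  finally show ?thesis by (simp add: prod_uminus)
qed

text \<open>Expanding over the subsets \<open>S\<close> of the variables, \<open>S\<close>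
  contributes to the power \<open>r * card S\<close> the monomial with exponent \<open>r\<close> on
  \<open>S\<close>. As \<open>r \<ge> 1\<close>, such a monomial determines \<open>S\<close> as its
  set of keys.\<close>

lemma fps_nth_prod_e_pow:
  assumes "finite V" "r \<ge> 1"
  shows "fps_nth (\<Prod>v\<in>V \<inter> {i} \<times> {1..}. 1 - (fps_const (xvar v) * fps_X) ^ r) (r * m) =
    restr V (e_pow r i m)"
proof -
  let ?W = "V \<inter> {i} \<times> {1..}"
  let ?g = "\<lambda>S. \<Sum>v\<in>S. Poly_Mapping.single v r :: monomial"
  have fin: "finite ?W" using assms by simp
  have "(\<Prod>v\<in>?W. 1 - (fps_const (xvar v) * fps_X) ^ r) =
      (\<Sum>S\<in>Pow ?W. (-1) ^ card S * (\<Prod>v\<in>S. (fps_const (xvar v) * fps_X) ^ r))"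
    by (rule prod_one_minus[OF fin])
  also have "\<dots> = (\<Sum>S\<in>Pow ?W. fps_const ((-1) ^ card S * monom_ser (?g S)) * fps_X ^ (r * card S))"
  proof (rule sum.cong)
    fix S assume "S \<in> Pow ?W"
    then have "finite S" using finite_subset[OF _ fin] by blast
    have "(\<Prod>v\<in>S. (fps_const (xvar v) * fps_X) ^ r) =
        (\<Prod>v\<in>S. fps_const (monom_ser (Poly_Mapping.single v r)) * fps_X ^ r)"
      by (simp add: power_mult_distrib monom_ser_single_power[unfolded One_nat_def] fps_const_power)
    also have "\<dots> = fps_const (monom_ser (?g S)) * fps_X ^ (r * card S)"
      using \<open>finite S\<close>
      by (induction S rule: finite_induct)
        (auto simp: monom_ser_0 monom_ser_add power_add algebra_simps simp flip: fps_const_mult)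
    also have "(-1) ^ card S * (fps_const (monom_ser (?g S)) * fps_X ^ (r * card S)) =
        fps_const ((-1) ^ card S * monom_ser (?g S)) * fps_X ^ (r * card S)"
    proof -
      have "(-1) ^ k = fps_const ((-1 :: pser) ^ k)" for k by (simp flip: fps_const_power fps_const_neg)
      then show ?thesis by (simp add: mult.assoc flip: fps_const_mult)
    qed
    finally show "(-1) ^ card S * (\<Prod>v\<in>S. (fps_const (xvar v) * fps_X) ^ r) =
        fps_const ((-1) ^ card S * monom_ser (?g S)) * fps_X ^ (r * card S)" .
  qed simp
  finally have "fps_nth (\<Prod>v\<in>?W. 1 - (fps_const (xvar v) * fps_X) ^ r) (r * m) =
      (\<Sum>S\<in>Pow ?W. if card S = m then (-1) ^ m * monom_ser (?g S) else 0)"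
    using assms by (auto simp: fps_sum_nth fps_X_power_iff intro!: sum.cong)
  also have "\<dots> = restr V (e_pow r i m)"
  proof (rule pser_eqI)
    fix f :: monomial
    let ?K = "Poly_Mapping.keys f"
    have lookup: "Poly_Mapping.lookup (?g S) v = (if v \<in> S then r else 0)" if "finite S" for S v
      using that by (simp add: lookup_sum lookup_single when_def sum.delta')
    have g: "f = ?g S \<longleftrightarrow> S = ?K \<and> (\<forall>v\<in>?K. Poly_Mapping.lookup f v = r)" if "finite S" for S
    proof
      assume f: "f = ?g S"
      then show "S = ?K \<and> (\<forall>v\<in>?K. Poly_Mapping.lookup f v = r)"
        using lookup[OF that] assms(2) by (auto simp: in_keys_iff split: if_splits)
    next
      assume "S = ?K \<and> (\<forall>v\<in>?K. Poly_Mapping.lookup f v = r)"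
      then show "f = ?g S" using lookup[OF that]
        by (intro poly_mapping_eqI) (auto simp: in_keys_iff)
    qed
    have "coeff (\<Sum>S\<in>Pow ?W. if card S = m then (-1) ^ m * monom_ser (?g S) else 0) f =
        (\<Sum>S\<in>Pow ?W. if S = ?K then (if (\<forall>v\<in>?K. Poly_Mapping.lookup f v = r) \<and> card ?K = m then (-1) ^ m else 0) else 0)"
      unfolding coeff_sum
    proof (rule sum.cong)
      fix S assume "S \<in> Pow ?W"
      then have "finite S" using finite_subset[OF _ fin] by blast
      have "coeff ((-1) ^ m * monom_ser (?g S)) f = (-1) ^ m * (if f = ?g S then 1 else 0)"
        using coeff_of_int_times[of "(-1) ^ m" "monom_ser (?g S)" f] by simp
      then show "coeff (if card S = m then (-1) ^ m * monom_ser (?g S) else 0) f =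
          (if S = ?K then (if (\<forall>v\<in>?K. Poly_Mapping.lookup f v = r) \<and> card ?K = m then (-1) ^ m else 0) else 0)"
        using g[OF \<open>finite S\<close>] by auto
    qed simp
    also have "\<dots> = coeff (restr V (e_pow r i m)) f"
    proof -
      have "finite (Pow ?W)" using fin by (simp only: finite_Pow_iff)
      then show ?thesis by (subst sum.delta) (auto simp: e_pow_def)
    qed
    finally show "coeff (\<Sum>S\<in>Pow ?W. if card S = m then (-1) ^ m * monom_ser (?g S) else 0) f =
        coeff (restr V (e_pow r i m)) f" .
  qed
  finally show ?thesis .
qed

text \<open>The generating series of the complete homogeneous functions in the variables
  \<open>W\<close>, that is, of all monomials in \<open>W\<close> by total degree.\<close>

definition h_fps :: "(nat \<times> nat) set \<Rightarrow> pser fps" where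
  "h_fps W = Abs_fps (\<lambda>n. PSer (\<lambda>f. if Poly_Mapping.keys f \<subseteq> W \<and> tdeg f = n then 1 else 0))"

text \<open>Multiplication by \<open>v\<close> matches the monomials of degree \<open>n - 1\<close>
  with those of degree \<open>n\<close> containing \<open>v\<close>. These cancel, and the monomials
  without \<open>v\<close> remain.\<close>

lemma h_fps_insert:
  assumes "v \<notin> W"
  shows "(1 - fps_const (xvar v) * fps_X) * h_fps (insert v W) = h_fps W"
proof (rule fps_ext)
  fix n
  have eq: "(1 - fps_const (xvar v) * fps_X) * h_fps (insert v W) =
      h_fps (insert v W) - fps_const (xvar v) * (fps_X * h_fps (insert v W))"
    by (simp add: algebra_simps)
  show "fps_nth ((1 - fps_const (xvar v) * fps_X) * h_fps (insert v W)) n = fps_nth (h_fps W) n"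
  proof (rule pser_eqI)
    fix f
    show "coeff (fps_nth ((1 - fps_const (xvar v) * fps_X) * h_fps (insert v W)) n) f =
        coeff (fps_nth (h_fps W) n) f"
    proof (cases "v \<in> Poly_Mapping.keys f")
      case True
      define f' where "f' = f - Poly_Mapping.single v 1"
      have f: "f = Poly_Mapping.single v 1 + f'"
        using True by (intro poly_mapping_eqI)
          (auto simp: f'_def lookup_add lookup_minus lookup_single when_def in_keys_iff)
      have "tdeg (Poly_Mapping.single v 1) = 1" by (simp add: tdeg_def)
      then have "tdeg f = Suc (tdeg f')" by (simp add: f tdeg_add)
      moreover have "Poly_Mapping.keys f = insert v (Poly_Mapping.keys f')"
        unfolding f keys_add_nat by simp
      moreover have "\<exists>f'. f = Poly_Mapping.single v (Suc 0) + f'" using f by auto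
      ultimately show ?thesis
        using assms unfolding eq
        by (cases n) (auto simp: h_fps_def coeff_monom_ser_times simp flip: f'_def[unfolded One_nat_def])
    next
      case False
      then have "\<not> (\<exists>f'. f = Poly_Mapping.single v 1 + f')"
        by (auto simp: keys_add_nat)
      then show ?thesis
        using False unfolding eq by (auto simp: h_fps_def coeff_monom_ser_times)
    qed
  qed
qed

lemma h_fps_inverse:
  assumes "finite W"
  shows "h_fps W * (\<Prod>v\<in>W. 1 - fps_const (xvar v) * fps_X) = 1"
  using assms
proof (induction W rule: finite_induct)
  case empty
  show ?case
    by (rule fps_ext, rule pser_eqI) (auto simp: h_fps_def coeff_1 tdeg_eq_0_iff tdeg_def)
next
  case (insert v W)
  have "h_fps (insert v W) * (\<Prod>v\<in>insert v W. 1 - fps_const (xvar v) * fps_X) =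
      ((1 - fps_const (xvar v) * fps_X) * h_fps (insert v W)) * (\<Prod>v\<in>W. 1 - fps_const (xvar v) * fps_X)"
    using insert.hyps by (simp add: mult_ac)
  also have "\<dots> = 1" unfolding h_fps_insert[OF insert.hyps(2)] by (rule insert.IH)
  finally show ?case .
qed

lemma h_fps_nth:
  "fps_nth (h_fps (V \<inter> {i} \<times> {1..})) k = restr V (h_sym i k)"
  by (rule pser_eqI) (auto simp: h_fps_def h_sym_def tdeg_def)

lemma prod_list_uminus_map:
  fixes f :: "'b \<Rightarrow> 'a::comm_ring_1"
  shows "prod_list (map (\<lambda>j. - f j) xs) = (-1) ^ length xs * prod_list (map f xs)"
  by (induction xs) auto

text \<open>\<open>e_pow 1 i n\<close> is the \<open>n\<close>-th elementary symmetric function of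
  row \<open>i\<close> up to the sign \<open>(-1)^n\<close>. These are the coefficients of the
  series inverse to that of the \<open>h_sym i\<close>, as is checked for finitely many
  variables.\<close>

lemma e_pow_eq_sum_comps:
  "e_pow 1 i n = (\<Sum>\<beta>\<in>comps n. prod_list (map (\<lambda>k. - h_sym i k) \<beta>))"
proof (rule inverse_series_comps)
  show "e_pow 1 i 0 = 1"
    by (rule pser_eqI) (auto simp: e_pow_def coeff_1)
  show "h_sym i 0 = 1"
    by (rule pser_eqI) (auto simp: h_sym_def coeff_1 in_keys_iff intro!: poly_mapping_eqI)
  fix n :: nat assume n: "n > 0"
  show "(\<Sum>k\<le>n. h_sym i k * e_pow 1 i (n - k)) = 0"
  proof (rule restr_eqI)
    fix V :: "(nat \<times> nat) set" assume V: "finite V"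
    let ?W = "V \<inter> {i} \<times> {1..}"
    have "fps_nth (h_fps ?W * (\<Prod>v\<in>?W. 1 - fps_const (xvar v) * fps_X)) n = 0"
      using h_fps_inverse[of ?W] V n by simp
    moreover have "fps_nth (\<Prod>v\<in>?W. 1 - fps_const (xvar v) * fps_X) k = restr V (e_pow 1 i k)" for k
      using fps_nth_prod_e_pow[OF V, of 1 i k] by simp
    ultimately show "restr V (\<Sum>k\<le>n. h_sym i k * e_pow 1 i (n - k)) = restr V 0"
      by (simp add: fps_mult_nth h_fps_nth restr_sum restr_times restr_0 atLeast0AtMost del: One_nat_def)
  qed
qed

text \<open>The determinant of the circulant of the row series is evaluated in two ways: as a
  product over the variables it gives \<open>e_pow r i m\<close>, by the Leibniz formula the sum
  over labeled compositions.\<close>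

lemma e_pow_eq_sum_lcomps:
  assumes "r \<ge> 1"
  shows "e_pow r i m = (\<Sum>(\<beta>, L)\<in>lcomps r (r * m).
    of_int (shat r (label_sums \<beta> L)) * prod_list (map (\<lambda>k. - h_sym i k) \<beta>))"
proof (rule restr_eqI)
  fix V :: "(nat \<times> nat) set" assume V: "finite V"
  let ?W = "V \<inter> {i} \<times> {1..}"
  let ?E = "\<Prod>v\<in>?W. 1 - fps_const (xvar v) * fps_X"
  have E: "fps_nth ?E = (\<lambda>k. restr V (e_pow 1 i k))"
    using fps_nth_prod_e_pow[OF V, of 1 i] by (intro ext) simp
  have "(\<Sum>(\<beta>, L)\<in>lcomps r (r * m).
      of_int (shat r (label_sums \<beta> L)) * prod_list (map (\<lambda>k. - h_sym i k) \<beta>)) =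
    (\<Sum>w\<in>natpermute (r * m) r. of_int (shat_word r w) * prod_list (map (e_pow 1 i) w))"
    \<comment> \<open>Summing over the groups with given sums restores the coefficients
      \<open>e_pow 1 i\<close>; then the compositions of at most \<open>r\<close> parts are filled
      up by zeros to words of length \<open>r\<close>.\<close>
    unfolding sum_lcomps e_pow_eq_sum_comps[symmetric]
    by (rule sum_shat_comps) (auto intro!: pser_eqI simp: e_pow_def coeff_1)
  then have "restr V (\<Sum>(\<beta>, L)\<in>lcomps r (r * m).
      of_int (shat r (label_sums \<beta> L)) * prod_list (map (\<lambda>k. - h_sym i k) \<beta>)) =
    (\<Sum>w\<in>natpermute (r * m) r. of_int (shat_word r w) * prod_list (map (fps_nth ?E) w))"
    by (simp add: restr_sum restr_of_int_times restr_prod_list E comp_def del: One_nat_def)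
  also have "\<dots> = fps_nth (det (circulant r ?E)) (r * m)"
    by (rule det_circulant_nth[symmetric])
  also have "\<dots> = restr V (e_pow r i m)"
    by (subst det_circulant_prod[OF assms]) (use V fps_nth_prod_e_pow[OF V assms] in simp_all)
  finally show "restr V (e_pow r i m) = restr V (\<Sum>(\<beta>, L)\<in>lcomps r (r * m).
      of_int (shat r (label_sums \<beta> L)) * prod_list (map (\<lambda>k. - h_sym i k) \<beta>))" ..
qed

section \<open>Expansion over labeled polywrappings\<close>

definition row :: "nat \<Rightarrow> monomial \<Rightarrow> monomial" where
  "row k f = Abs_poly_mapping (\<lambda>v. if fst v = k then Poly_Mapping.lookup f v else 0)"

lemma lookup_row: "Poly_Mapping.lookup (row k f) v = (if fst v = k then Poly_Mapping.lookup f v else 0)"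
proof -
  have "finite {v. (if fst v = k then Poly_Mapping.lookup f v else 0) \<noteq> 0}"
    by (rule finite_subset[OF _ finite_keys[of f]]) (auto simp: in_keys_iff split: if_splits)
  then show ?thesis unfolding row_def by (subst lookup_Abs_poly_mapping) auto
qed

lemma keys_row: "Poly_Mapping.keys (row k f) = {v \<in> Poly_Mapping.keys f. fst v = k}"
  by (auto simp: in_keys_iff lookup_row split: if_splits)

text \<open>The factors live in disjoint sets of variables, so the only factorization of
  \<open>f\<close> that contributes is the one into its rows.\<close>

lemma coeff_prod_rows:
  assumes "finite I" "\<And>k g. k \<in> I \<Longrightarrow> coeff (F k) g \<noteq> 0 \<Longrightarrow> Poly_Mapping.keys g \<subseteq> {k} \<times> UNIV"
  shows "coeff (\<Prod>k\<in>I. F k) f =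
    (if fst ` Poly_Mapping.keys f \<subseteq> I then \<Prod>k\<in>I. coeff (F k) (row k f) else 0)"
  using assms
proof (induction I arbitrary: f rule: finite_induct)
  case empty
  have "Poly_Mapping.keys f = {} \<longleftrightarrow> f = 0" by (rule keys_eq_empty)
  then show ?case by (simp add: coeff_1)
next
  case (insert k I)
  let ?P = "\<Prod>k\<in>I. F k"
  let ?rest = "f - row k f"
  have IH: "coeff ?P g = (if fst ` Poly_Mapping.keys g \<subseteq> I then \<Prod>k\<in>I. coeff (F k) (row k g) else 0)" for g
    using insert.prems by (intro insert.IH) auto
  have split: "row k f + ?rest = f"
    by (rule poly_mapping_eqI) (simp add: lookup_add lookup_minus lookup_row)
  have keys_rest: "Poly_Mapping.keys ?rest = {v \<in> Poly_Mapping.keys f. fst v \<noteq> k}"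
    by (auto simp: in_keys_iff lookup_row lookup_minus split: if_splits)
  have uniq: "a = row k f \<and> b = ?rest" if "a + b = f" "coeff (F k) a \<noteq> 0" "coeff ?P b \<noteq> 0" for a b
  proof -
    have a: "Poly_Mapping.keys a \<subseteq> {k} \<times> UNIV" using insert.prems that by blast
    have "fst ` Poly_Mapping.keys b \<subseteq> I" using that(3) by (simp add: IH split: if_splits)
    then have b: "fst v \<noteq> k" if "v \<in> Poly_Mapping.keys b" for v using that insert.hyps by auto
    have "a = row k f"
    proof (rule poly_mapping_eqI)
      fix v
      show "Poly_Mapping.lookup a v = Poly_Mapping.lookup (row k f) v"
        using a b[of v] by (cases "fst v = k") (auto simp: lookup_row lookup_add in_keys_iff simp flip: that(1))
    qed
    moreover from this have "b = ?rest" using split that(1) by (metis add_left_imp_eq)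
    ultimately show ?thesis ..
  qed
  have "coeff (F k * ?P) f = (\<Sum>(a, b)\<in>{(row k f, ?rest)}. coeff (F k) a * coeff ?P b)"
    unfolding coeff_times
  proof (rule sum.mono_neutral_right)
    show "\<forall>p\<in>{(a, b). a + b = f} - {(row k f, ?rest)}. (case p of (a, b) \<Rightarrow> coeff (F k) a * coeff ?P b) = 0"
      using uniq by auto
  qed (use split in \<open>auto simp: finite_splits\<close>)
  also have "\<dots> = coeff (F k) (row k f) * coeff ?P ?rest" by simp
  also have "coeff ?P ?rest = (if fst ` Poly_Mapping.keys f \<subseteq> insert k I then \<Prod>j\<in>I. coeff (F j) (row j f) else 0)"
  proof -
    have "row j ?rest = row j f" if "j \<in> I" for j
      using that insert.hyps by (intro poly_mapping_eqI) (auto simp: lookup_row lookup_minus)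
    moreover have "fst ` Poly_Mapping.keys ?rest \<subseteq> I \<longleftrightarrow> fst ` Poly_Mapping.keys f \<subseteq> insert k I"
      using insert.hyps by (auto simp: keys_rest)
    ultimately show ?thesis unfolding IH by (auto intro: prod.cong)
  qed
  finally show ?case using insert.hyps by auto
qed

text \<open>The partitions of \<open>d\<close> in multiplicity notation, \<open>m k\<close> being
  the number of parts \<open>k\<close>. The functions are extensional so that distinct functions are
  distinct partitions.\<close>

definition weak_decomps :: "nat \<Rightarrow> (nat \<Rightarrow> nat) set" where
  "weak_decomps d = {m \<in> {1..d} \<rightarrow>\<^sub>E {..d}. (\<Sum>k\<in>{1..d}. k * m k) = d}"

lemma finite_weak_decomps: "finite (weak_decomps d)"
  unfolding weak_decomps_def by (rule finite_subset[of _ "{1..d} \<rightarrow>\<^sub>E {..d}"]) (auto intro: finite_PiE)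

lemma weak_decompsI:
  assumes "m \<in> extensional {1..d}" "(\<Sum>k\<in>{1..d}. k * m k) = d"
  shows "m \<in> weak_decomps d"
proof -
  have "m k \<le> d" if "k \<in> {1..d}" for k
  proof -
    have "m k \<le> k * m k" using that by simp
    also have "\<dots> \<le> d" using member_le_sum[of k "{1..d}" "\<lambda>k. k * m k"] that assms(2) by simp
    finally show ?thesis .
  qed
  then show ?thesis using assms by (auto simp: weak_decomps_def PiE_def)
qed

text \<open>A square-free monomial of degree \<open>d\<close> is a choice of \<open>m k\<close>
  variables from each row \<open>k\<close> with the \<open>k * m k\<close> adding up to
  \<open>d\<close>; its sign is the product of the signs of its rows.\<close>

lemma subst_power_E_deg:
  assumes "r \<ge> 1"
  shows "subst_power r (E_deg d) = (\<Sum>m\<in>weak_decomps d. \<Prod>k\<in>{1..d}. e_pow r k (m k))"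
proof (rule pser_eqI)
  fix f :: monomial
  let ?K = "Poly_Mapping.keys f"
  \<comment> \<open>The shape of the monomials that can occur: \<open>r\<close>-th powers of
    square-free monomials in the rows 1 to \<open>d\<close>. For such an \<open>f\<close>, the
    function \<open>n\<close> defined next is the only \<open>m\<close> whose product contains
    it.\<close>
  define good where "good \<longleftrightarrow> ?K \<subseteq> {1..d} \<times> {1..} \<and> (\<forall>v\<in>?K. Poly_Mapping.lookup f v = r)"
  define n where "n = restrict (\<lambda>k. card (Poly_Mapping.keys (row k f))) {1..d}"
  have n_ext: "n \<in> extensional {1..d}" by (simp add: n_def)
  have Un: "?K = (\<Union>k\<in>{1..d}. Poly_Mapping.keys (row k f))" if good
    using that by (auto simp: good_def keys_row)
  have card_K: "card ?K = (\<Sum>k\<in>{1..d}. n k)" if good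
  proof -
    have "card ?K = card (\<Union>k\<in>{1..d}. Poly_Mapping.keys (row k f))" using Un[OF that] by simp
    also have "\<dots> = (\<Sum>k\<in>{1..d}. card (Poly_Mapping.keys (row k f)))"
      by (rule card_UN_disjoint) (auto simp: keys_row)
    finally show ?thesis by (simp add: n_def)
  qed
  have mdeg_f: "mdeg f = r * (\<Sum>k\<in>{1..d}. k * n k)" if good
  proof -
    have "mdeg f = (\<Sum>v\<in>(\<Union>k\<in>{1..d}. Poly_Mapping.keys (row k f)). fst v * Poly_Mapping.lookup f v)"
      using Un[OF that] by (simp add: mdeg_def)
    also have "\<dots> = (\<Sum>k\<in>{1..d}. \<Sum>v\<in>Poly_Mapping.keys (row k f). fst v * Poly_Mapping.lookup f v)"
      by (rule sum.UNION_disjoint) (auto simp: keys_row)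
    also have "\<dots> = (\<Sum>k\<in>{1..d}. \<Sum>v\<in>Poly_Mapping.keys (row k f). k * r)"
      using that by (intro sum.cong refl) (auto simp: keys_row good_def)
    finally show ?thesis by (simp add: n_def sum_distrib_left mult_ac)
  qed
  have rhs: "coeff (\<Prod>k\<in>{1..d}. e_pow r k (m k)) f = (if good \<and> m = n then (-1) ^ card ?K else 0)"
    if m: "m \<in> weak_decomps d" for m
  proof -
    have "coeff (\<Prod>k\<in>{1..d}. e_pow r k (m k)) f =
        (if fst ` ?K \<subseteq> {1..d} then \<Prod>k\<in>{1..d}. coeff (e_pow r k (m k)) (row k f) else 0)"
      by (rule coeff_prod_rows) (auto simp: e_pow_def split: if_splits)
    also have "\<dots> = (if good \<and> m = n then (-1) ^ card ?K else 0)"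
    proof (cases "good \<and> m = n")
      case True
      then have "fst ` ?K \<subseteq> {1..d}" by (auto simp: good_def)
      moreover have "coeff (e_pow r k (m k)) (row k f) = (-1) ^ n k" if "k \<in> {1..d}" for k
        using True that by (auto simp: e_pow_def n_def good_def keys_row lookup_row)
      ultimately show ?thesis using True card_K by (simp add: power_sum)
    next
      case False
      have False if sub: "fst ` ?K \<subseteq> {1..d}" and nz: "\<And>k. k \<in> {1..d} \<Longrightarrow> coeff (e_pow r k (m k)) (row k f) \<noteq> 0"
      proof -
        have *: "Poly_Mapping.keys (row k f) \<subseteq> {k} \<times> {1..} \<and>
            (\<forall>v\<in>Poly_Mapping.keys (row k f). Poly_Mapping.lookup (row k f) v = r) \<and>
            card (Poly_Mapping.keys (row k f)) = m k" if "k \<in> {1..d}" for k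
          using nz[OF that] by (simp add: e_pow_def split: if_splits)
        have "v \<in> {1..d} \<times> {1..} \<and> Poly_Mapping.lookup f v = r" if "v \<in> ?K" for v
        proof -
          have "fst v \<in> {1..d}" using sub that by auto
          moreover have "v \<in> Poly_Mapping.keys (row (fst v) f)" using that by (simp add: keys_row)
          ultimately show ?thesis using *[of "fst v"] by (cases v) (auto simp: lookup_row)
        qed
        then have good by (auto simp: good_def)
        moreover have "m = n"
        proof (rule extensionalityI[of _ "{1..d}"])
          show "m \<in> extensional {1..d}" using m by (auto simp: weak_decomps_def PiE_def)
        qed (use n_ext * in \<open>auto simp: n_def\<close>)
        ultimately show False using False by blast
      qed
      then have "\<exists>k\<in>{1..d}. coeff (e_pow r k (m k)) (row k f) = 0" if "fst ` ?K \<subseteq> {1..d}"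
        using that by blast
      then have "(\<Prod>k\<in>{1..d}. coeff (e_pow r k (m k)) (row k f)) = 0" if "fst ` ?K \<subseteq> {1..d}"
        using that by (intro prod_zero) auto
      with False show ?thesis by auto
    qed
    finally show ?thesis .
  qed
  have "coeff (\<Sum>m\<in>weak_decomps d. \<Prod>k\<in>{1..d}. e_pow r k (m k)) f =
      (\<Sum>m\<in>weak_decomps d. if m = n then (if good then (-1) ^ card ?K else 0) else 0)"
    unfolding coeff_sum by (intro sum.cong refl) (subst rhs, auto)
  also have "\<dots> = (if n \<in> weak_decomps d \<and> good then (-1) ^ card ?K else 0)"
    by (subst sum.delta) (auto simp: finite_weak_decomps)
  also have "n \<in> weak_decomps d \<and> good \<longleftrightarrow> good \<and> mdeg f = d * r"
  proof -
    have "n \<in> weak_decomps d \<longleftrightarrow> (\<Sum>k\<in>{1..d}. k * n k) = d"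
      using weak_decompsI[OF n_ext] unfolding weak_decomps_def by blast
    then show ?thesis using mdeg_f assms by (auto simp: mult.commute)
  qed
  also have "(if good \<and> mdeg f = d * r then (-1) ^ card ?K else 0) = coeff (subst_power r (E_deg d)) f"
  proof (cases "\<forall>v. r dvd Poly_Mapping.lookup f v")
    case False
    then obtain v where v: "\<not> r dvd Poly_Mapping.lookup f v" by blast
    then have "v \<in> ?K" by (auto simp: in_keys_iff intro: ccontr)
    then have "\<not> good" using v unfolding good_def by (metis dvd_refl)
    then show ?thesis using False by (simp only: subst_power_def pser.sel if_False simp_thms)
  next
    case True
    define q where "q = Poly_Mapping.map (\<lambda>e. e div r) f"
    have lookup: "Poly_Mapping.lookup f v = r * Poly_Mapping.lookup q v" for v
      using True[rule_format, of v] by (simp add: q_def map.rep_eq when_def)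
    have keys: "Poly_Mapping.keys q = ?K"
      using assms by (auto simp: in_keys_iff lookup)
    have mdeg: "mdeg f = r * mdeg q"
      unfolding mdeg_def keys by (simp add: lookup sum_distrib_left mult_ac)
    have "(?K \<subseteq> xvars \<and> (\<forall>v. Poly_Mapping.lookup q v \<le> 1) \<and> mdeg q = d) \<longleftrightarrow> good \<and> mdeg f = d * r"
    proof safe
      assume a: "?K \<subseteq> xvars" "\<forall>v. Poly_Mapping.lookup q v \<le> 1" "d = mdeg q"
      have one: "Poly_Mapping.lookup q v = 1" if "v \<in> ?K" for v
        using a(2)[rule_format, of v] that unfolding keys[symmetric] in_keys_iff by linarith
      \<comment> \<open>No variable of a monomial of degree \<open>d\<close> lies in a row beyond
        \<open>d\<close>, which is why the product over the rows 1 to \<open>d\<close>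
        suffices.\<close>
      have "fst v \<le> mdeg q" if "v \<in> ?K" for v
      proof -
        have "fst v * Poly_Mapping.lookup q v \<le> mdeg q"
          unfolding mdeg_def keys using that by (intro member_le_sum) auto
        then show ?thesis by (simp add: one[OF that])
      qed
      then show good using a one by (fastforce simp: good_def lookup xvars_def)
      show "mdeg f = mdeg q * r" by (simp add: mdeg)
    next
      assume a: good "mdeg f = d * r"
      show "v \<in> xvars" if "v \<in> ?K" for v using a(1) that by (auto simp: good_def xvars_def)
      show "Poly_Mapping.lookup q v \<le> 1" for v
        using a(1) assms by (cases "v \<in> ?K") (auto simp: good_def lookup keys[symmetric] in_keys_iff)
      show "mdeg q = d" using a(2) assms mdeg by simp
    qed
    then show ?thesis using True by (simp add: subst_power_def E_deg_def keys flip: q_def del: split_paired_All)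
  qed
  finally show "coeff (subst_power r (E_deg d)) f =
      coeff (\<Sum>m\<in>weak_decomps d. \<Prod>k\<in>{1..d}. e_pow r k (m k)) f" ..
qed

section \<open>Box counts of wrappings and types of labelings\<close>

text \<open>Each sheet-column has \<open>k\<close> boxes and distinct ones are disjoint, so a
  rectangle made of \<open>\<beta> ! j\<close> of them has \<open>k * \<beta> ! j\<close>
  boxes.\<close>

lemma card_wrapping:
  assumes "r \<ge> 1" "j < length \<beta>"
  shows "card (wrapping r k \<beta> ! j) = k * \<beta> ! j"
proof -
  let ?I = "{sum_list (take j \<beta>)..<sum_list (take (Suc j) \<beta>)}"
  have "wrapping r k \<beta> ! j = (\<Union>s\<in>?I. sheet_column r k s)"
    using assms(2) by (simp add: wrapping_def)
  also have "card \<dots> = (\<Sum>s\<in>?I. card (sheet_column r k s))"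
  proof (rule card_UN_disjoint)
    show "\<forall>s\<in>?I. \<forall>t\<in>?I. s \<noteq> t \<longrightarrow> sheet_column r k s \<inter> sheet_column r k t = {}"
    proof (intro ballI impI, rule ccontr)
      fix s t assume "s \<noteq> t" "sheet_column r k s \<inter> sheet_column r k t \<noteq> {}"
      then obtain a c where a: "s div r * k \<le> a" "a < s div r * k + k" "c = s mod r"
          "t div r * k \<le> a" "a < t div r * k + k" "c = t mod r"
        unfolding sheet_column_def by fastforce
      \<comment> \<open>A box determines its sheet-column: its row number divided by
        \<open>k\<close> is the number of the sheet, and its column number is the remainder.\<close>
      have "a div k = s div r" "a div k = t div r"
        using a by (auto intro!: div_nat_eqI simp: algebra_simps)
      then have "s div r = t div r" "s mod r = t mod r" using a by auto
      then have "s = t" by (metis div_mult_mod_eq)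
      with \<open>s \<noteq> t\<close> show False by simp
    qed
  qed (auto simp: sheet_column_def)
  also have "\<dots> = k * \<beta> ! j"
    using assms(2) by (simp add: sheet_column_def take_Suc_conv_app_nth)
  finally show ?thesis .
qed

lemma length_wrapping: "length (wrapping r k \<beta>) = length \<beta>"
  by (simp add: wrapping_def)

lemma length_polywrapping: "length (polywrapping r \<gamma> k) = length (\<gamma> k)"
  by (simp add: polywrapping_def length_wrapping)

lemma card_polywrapping:
  assumes "r \<ge> 1" "j < length (\<gamma> k)"
  shows "card (polywrapping r \<gamma> k ! j) = k * \<gamma> k ! j"
proof -
  have "card (polywrapping r \<gamma> k ! j) = card (wrapping r k (\<gamma> k) ! j)"
    using assms(2) by (auto simp: polywrapping_def length_wrapping inj_on_def intro!: card_image)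
  then show ?thesis using card_wrapping[OF assms] by simp
qed

lemma labeling_otype_eq:
  assumes "r \<ge> 1" "rects D = polywrapping r (pocon D)" "k \<ge> 1"
  shows "labeling_otype D k = label_sums (pocon D k) (labels D k)"
proof -
  have "(\<Sum>j | j < length (rects D k) \<and> labels D k ! j = i. card (rects D k ! j)) div k =
      (\<Sum>j | j < length (pocon D k) \<and> labels D k ! j = i. pocon D k ! j)" for i
  proof -
    have "(\<Sum>j | j < length (rects D k) \<and> labels D k ! j = i. card (rects D k ! j)) =
        (\<Sum>j | j < length (pocon D k) \<and> labels D k ! j = i. k * pocon D k ! j)"
      using assms by (intro sum.cong) (auto simp: length_polywrapping card_polywrapping)
    then show ?thesis using assms(3) by (simp flip: sum_distrib_left)
  qed
  then show ?thesis by (simp add: labeling_otype_def label_sums_def)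
qed

lemma shat_Nil [simp]: "shat r [] = 1"
proof -
  have "{w. length w = r \<and> filter (\<lambda>x. x \<noteq> 0) w = []} = {replicate r (0::nat)}"
    by (auto simp: filter_empty_conv intro!: replicate_eqI)
  moreover have "shat_word r (replicate r 0) = 1"
  proof -
    have v: "(replicate r 0 ! i + i) mod r = i" if "i < r" for i using that by simp
    have "inj_on (\<lambda>i. (replicate r 0 ! i + i) mod r) {..<r}"
      by (rule inj_onI) (simp add: v)
    moreover have "{(i, j). i < j \<and> j < r \<and> (replicate r 0 ! i + i) mod r > (replicate r 0 ! j + j) mod r} = {}"
      by auto
    ultimately show ?thesis by (simp only: shat_word_def Let_def if_True card.empty power_0)
  qed
  ultimately show ?thesis by (simp add: shat_def)
qed

text \<open>A nonempty entry has positive sum divisible by \<open>r\<close>, hence at least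
  \<open>r\<close>, and so takes at least \<open>k * r\<close> of the total weight
  \<open>d * r\<close>.\<close>

lemma OTyp_div_bound:
  assumes "\<gamma> \<in> OTyp_div r (d * r)" "r \<ge> 1" "\<gamma> k \<noteq> []"
  shows "k \<in> {1..d}"
proof -
  have ot: "is_otype \<gamma>" "otype_weight \<gamma> = d * r" "r dvd sum_list (\<gamma> k)"
    using assms(1) by (auto simp: OTyp_div_def OTyp_def)
  then have fin: "finite {i. \<gamma> i \<noteq> []}" and "\<gamma> 0 = []"
    by (auto simp: is_otype_def)
  have pos: "x \<ge> 1" if "x \<in> set (\<gamma> k)" for x
    using ot(1) that by (auto simp: is_otype_def)
  have "k \<noteq> 0" using assms(3) \<open>\<gamma> 0 = []\<close> by (cases k) auto
  obtain x xs where x: "\<gamma> k = x # xs" using assms(3) by (cases "\<gamma> k") auto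
  then have "sum_list (\<gamma> k) > 0" using pos[of x] by simp
  then have "r \<le> sum_list (\<gamma> k)" using ot(3) by (simp add: dvd_imp_le)
  then have "k * r \<le> k * sum_list (\<gamma> k)" by simp
  also have "\<dots> \<le> d * r"
    using member_le_sum[of k "{i. \<gamma> i \<noteq> []}" "\<lambda>i. i * sum_list (\<gamma> i)"] fin assms(3) ot(2)
    by (simp add: otype_weight_def)
  finally show ?thesis using assms(2) \<open>k \<noteq> 0\<close> by auto
qed

section \<open>Labeled polywrappings as the terms of the expansion\<close>

text \<open>The contribution of one height; the sign by the number of rectangles is carried by the
  factors \<open>- h_sym k j\<close>.\<close>

definition lpw_weight :: "nat \<Rightarrow> nat \<Rightarrow> nat list \<Rightarrow> nat list \<Rightarrow> pser" where
  "lpw_weight r k \<beta> L = of_int (shat r (label_sums \<beta> L)) * prod_list (map (\<lambda>j. - h_sym k j) \<beta>)"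

lemma lpw_weight_eq:
  assumes "D \<in> labeled_polywrappings d r" "r \<ge> 1"
  shows "of_int ((-1) ^ otype_area (pocon D) * lpw_sgn r D) * h_tensor (pocon D) =
    (\<Prod>k\<in>{1..d}. lpw_weight r k (pocon D k) (labels D k))"
proof -
  let ?\<gamma> = "pocon D"
  have \<gamma>: "?\<gamma> \<in> OTyp_div r (d * r)" and rects: "rects D = polywrapping r ?\<gamma>"
    and lab: "length (labels D k) = length (rects D k)" for k
    using assms by (auto simp: labeled_polywrappings_def)
  have sub: "{k. ?\<gamma> k \<noteq> []} \<subseteq> {1..d}" using OTyp_div_bound[OF \<gamma> assms(2)] by blast
  have pos: "0 \<notin> set (?\<gamma> k)" for k
    using \<gamma> by (force simp: OTyp_div_def OTyp_def is_otype_def)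
  have labels_Nil: "labels D k = []" if "?\<gamma> k = []" for k
    using lab[of k] that by (simp add: rects length_polywrapping)
  \<comment> \<open>Height 0 is treated apart, because \<open>labeling_otype_eq\<close> divides by
    the height; there are no rectangles and no labels there.\<close>
  have \<gamma>0: "?\<gamma> 0 = []" using OTyp_div_bound[OF \<gamma> assms(2), of 0] by auto
  then have "labeling_otype D 0 = []" using labels_Nil[of 0] by (simp add: labeling_otype_def)
  then have lot: "labeling_otype D k = label_sums (?\<gamma> k) (labels D k)" for k
    using labeling_otype_eq[OF assms(2) rects, of k] labels_Nil[OF \<gamma>0]
    by (cases "k = 0") (auto simp: label_sums_def)
  have lot_sub: "{k. labeling_otype D k \<noteq> []} \<subseteq> {1..d}"
  proof clarify
    fix k assume "labeling_otype D k \<noteq> []"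
    then have "?\<gamma> k \<noteq> []" using labels_Nil[of k] by (auto simp: lot label_sums_def)
    then show "k \<in> {1..d}" using sub by blast
  qed
  have length_eq: "otype_length ?\<gamma> = (\<Sum>k\<in>{1..d}. length (?\<gamma> k))"
    unfolding otype_length_def by (rule sum.mono_neutral_left) (use sub in auto)
  have area_eq: "otype_area ?\<gamma> = (\<Sum>k\<in>{1..d}. sum_list (?\<gamma> k))"
    unfolding otype_area_def by (rule sum.mono_neutral_left) (use sub in auto)
  \<comment> \<open>Parts are positive, so the subtraction in the exponent of \<open>lpw_sgn\<close>
    is not truncated. The area then occurs twice in the total sign and only the length is
    left.\<close>
  have "otype_length ?\<gamma> \<le> otype_area ?\<gamma>"
    unfolding length_eq area_eq using length_le_sum_list[OF pos] by (intro sum_mono) auto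
  then have "(-1 :: int) ^ otype_area ?\<gamma> * (-1) ^ (otype_area ?\<gamma> - otype_length ?\<gamma>) = (-1) ^ otype_length ?\<gamma>"
    by (auto simp flip: power_add simp: minus_one_power_iff)
  then have sgn: "(-1) ^ otype_area ?\<gamma> * lpw_sgn r D =
      (-1) ^ otype_length ?\<gamma> * shat_otype r (labeling_otype D)"
    by (simp add: lpw_sgn_def flip: mult.assoc)
  have sh: "shat_otype r (labeling_otype D) = (\<Prod>k\<in>{1..d}. shat r (label_sums (?\<gamma> k) (labels D k)))"
    unfolding shat_otype_def lot[symmetric] by (rule prod.mono_neutral_left) (use lot_sub in auto)
  have ht: "h_tensor ?\<gamma> = (\<Prod>k\<in>{1..d}. prod_list (map (h_sym k) (?\<gamma> k)))"
    unfolding h_tensor_def by (rule prod.mono_neutral_left) (use sub in auto)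
  have "of_int ((-1) ^ otype_area ?\<gamma> * lpw_sgn r D) * h_tensor ?\<gamma> =
      (-1) ^ otype_length ?\<gamma> * of_int (shat_otype r (labeling_otype D)) * h_tensor ?\<gamma>"
    by (subst sgn) simp
  also have "\<dots> = (\<Prod>k\<in>{1..d}. (-1) ^ length (?\<gamma> k) * of_int (shat r (label_sums (?\<gamma> k) (labels D k))) *
        prod_list (map (h_sym k) (?\<gamma> k)))"
    unfolding sh ht by (simp add: length_eq power_sum prod.distrib)
  finally show ?thesis by (simp add: lpw_weight_def prod_list_uminus_map mult_ac)
qed

text \<open>The heights are independent: once the areas \<open>r * m k\<close> are fixed, any
  labeled compositions of these areas may be combined, and the rectangles follow from the ordered
  content.\<close>

lemma labeled_polywrappings_bij:
  assumes "r \<ge> 1"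
  shows "bij_betw (\<lambda>D. (\<lambda>k\<in>{1..d}. sum_list (pocon D k) div r, \<lambda>k\<in>{1..d}. (pocon D k, labels D k)))
    (labeled_polywrappings d r)
    (SIGMA m:weak_decomps d. \<Pi>\<^sub>E k\<in>{1..d}. lcomps r (r * m k))"
    (is "bij_betw ?f ?A ?B")
proof -
  \<comment> \<open>For the inverse map, the extensional functions on the heights 1 to
    \<open>d\<close> must be refilled with empty lists elsewhere, since \<open>pocon\<close> and
    \<open>labels\<close> are defined at every index.\<close>
  let ?ext = "\<lambda>\<phi> sel k. if k \<in> {1..d} then sel (\<phi> k) else []"
  let ?g = "\<lambda>(m, \<phi>). \<lparr>pocon = ?ext \<phi> fst, rects = polywrapping r (?ext \<phi> fst), labels = ?ext \<phi> snd\<rparr>"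
  show ?thesis
  proof (rule bij_betw_byWitness[where f' = ?g])
    have D: "pocon D \<in> OTyp_div r (d * r)" "rects D = polywrapping r (pocon D)"
      "\<And>k. length (labels D k) = length (pocon D k)" "\<And>k. sorted (labels D k)"
      "\<And>k. \<exists>m\<le>r. set (labels D k) = {1..m}" "\<And>k. k \<notin> {1..d} \<Longrightarrow> pocon D k = []"
      "\<And>k. k \<notin> {1..d} \<Longrightarrow> labels D k = []"
      if "D \<in> ?A" for D
    proof -
      have \<gamma>: "pocon D \<in> OTyp_div r (d * r)" and *: "rects D = polywrapping r (pocon D)"
        "\<And>k. length (labels D k) = length (rects D k)" "\<And>k. sorted (labels D k)"
        "\<And>k. \<exists>m\<le>r. set (labels D k) = {1..m}"
        using that by (auto simp: labeled_polywrappings_def)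
      have len: "length (labels D k) = length (pocon D k)" for k
        using *(1,2) by (simp add: length_polywrapping)
      have Nil: "pocon D k = []" if "k \<notin> {1..d}" for k
        using OTyp_div_bound[OF \<gamma> assms, of k] that by blast
      show "labels D k = []" if "k \<notin> {1..d}" for k using len[of k] Nil[OF that] by simp
      show "pocon D \<in> OTyp_div r (d * r)" "rects D = polywrapping r (pocon D)"
        "\<And>k. length (labels D k) = length (pocon D k)" "\<And>k. sorted (labels D k)"
        "\<And>k. \<exists>m\<le>r. set (labels D k) = {1..m}" "\<And>k. k \<notin> {1..d} \<Longrightarrow> pocon D k = []"
        using \<gamma> * len Nil by blast+
    qed
    show "\<forall>D\<in>?A. ?g (?f D) = D"
    proof
      fix D assume "D \<in> ?A"
      note D = D[OF this]
      have eqs: "?ext (\<lambda>k\<in>{1..d}. (pocon D k, labels D k)) fst = pocon D"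
        "?ext (\<lambda>k\<in>{1..d}. (pocon D k, labels D k)) snd = labels D"
        using D(6,7) by auto
      have "?g (?f D) = \<lparr>pocon = pocon D, rects = rects D, labels = labels D\<rparr>"
        by (simp only: prod.case eqs D(2))
      also have "\<dots> = D" by simp
      finally show "?g (?f D) = D" .
    qed
    show "?f ` ?A \<subseteq> ?B"
    proof (rule image_subsetI)
      fix D assume "D \<in> ?A"
      note D = D[OF this]
      have ot: "is_otype (pocon D)" "otype_weight (pocon D) = d * r" "\<And>k. r dvd sum_list (pocon D k)"
        using D(1) by (auto simp: OTyp_div_def OTyp_def)
      let ?m = "\<lambda>k\<in>{1..d}. sum_list (pocon D k) div r"
      have m: "r * ?m k = sum_list (pocon D k)" if "k \<in> {1..d}" for k
        using ot(3)[of k] that by simp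
      have "otype_weight (pocon D) = (\<Sum>k\<in>{1..d}. k * sum_list (pocon D k))"
        unfolding otype_weight_def
      proof (rule sum.mono_neutral_left)
        show "{k. pocon D k \<noteq> []} \<subseteq> {1..d}" using D(6) by blast
      qed auto
      also have "\<dots> = r * (\<Sum>k\<in>{1..d}. k * ?m k)"
        unfolding sum_distrib_left by (intro sum.cong refl) (metis m mult.left_commute)
      finally have "(\<Sum>k\<in>{1..d}. k * ?m k) = d" using ot(2) assms by simp
      then have "?m \<in> weak_decomps d" by (intro weak_decompsI) auto
      moreover have "(pocon D k, labels D k) \<in> lcomps r (r * ?m k)" if "k \<in> {1..d}" for k
      proof -
        have "0 \<notin> set (pocon D k)" using ot(1) by (force simp: is_otype_def)
        then show ?thesis unfolding m[OF that] using D(3-5) by (auto simp: lcomps_def comps_def)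
      qed
      ultimately show "?f D \<in> ?B" by auto
    qed
    have B: "?g (m, \<phi>) \<in> ?A \<and> ?f (?g (m, \<phi>)) = (m, \<phi>)" if "(m, \<phi>) \<in> ?B" for m \<phi>
    proof -
      have m: "m \<in> extensional {1..d}" "(\<Sum>k\<in>{1..d}. k * m k) = d" and \<phi>: "\<phi> \<in> extensional {1..d}"
        and lc: "\<And>k. k \<in> {1..d} \<Longrightarrow> (fst (\<phi> k), snd (\<phi> k)) \<in> lcomps r (r * m k)"
        using that by (auto simp: weak_decomps_def PiE_def)
      let ?\<gamma> = "?ext \<phi> fst" and ?L = "?ext \<phi> snd"
      have sum: "sum_list (?\<gamma> k) = r * m k" if "k \<in> {1..d}" for k
        using lc[OF that] that by (auto simp: lcomps_def comps_def)
      have sub: "{k. ?\<gamma> k \<noteq> []} \<subseteq> {1..d}" by (auto split: if_splits)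
      have "otype_weight ?\<gamma> = (\<Sum>k\<in>{1..d}. k * sum_list (?\<gamma> k))"
        unfolding otype_weight_def by (rule sum.mono_neutral_left) (use sub in auto)
      also have "\<dots> = (\<Sum>k\<in>{1..d}. r * (k * m k))"
        using sum by (intro sum.cong refl) (metis mult.left_commute)
      also have "\<dots> = d * r" using m(2) by (simp flip: sum_distrib_left)
      finally have weight: "otype_weight ?\<gamma> = d * r" .
      have "0 \<notin> set (?\<gamma> k)" for k
        using lc[of k] by (cases "k \<in> {1..d}") (auto simp: lcomps_def comps_def)
      then have pos: "1 \<le> x" if "x \<in> set (?\<gamma> k)" for x k
        using that by (metis less_one not_less)
      have "is_otype ?\<gamma>"
        using pos finite_subset[OF sub] unfolding is_otype_def by auto
      moreover have "r dvd sum_list (?\<gamma> k)" for k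
        using sum[of k] by (cases "k \<in> {1..d}") auto
      ultimately have \<gamma>: "?\<gamma> \<in> OTyp_div r (d * r)" using weight by (simp add: OTyp_div_def OTyp_def)
      have L: "length (?L k) = length (?\<gamma> k)" "sorted (?L k)" "\<exists>m\<le>r. set (?L k) = {1..m}" for k
        using lc[of k] by (cases "k \<in> {1..d}"; fastforce simp: lcomps_def)+
      have "?g (m, \<phi>) \<in> ?A"
        unfolding labeled_polywrappings_def using \<gamma> L by (simp add: length_polywrapping)
      moreover have "(\<lambda>k\<in>{1..d}. sum_list (?\<gamma> k) div r) = m"
        using m(1) sum assms by (intro extensionalityI[of _ "{1..d}"]) auto
      moreover have "(\<lambda>k\<in>{1..d}. (?\<gamma> k, ?L k)) = \<phi>"
        using \<phi> by (intro extensionalityI[of _ "{1..d}"]) auto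
      ultimately show ?thesis by simp
    qed
    show "\<forall>x\<in>?B. ?f (?g x) = x" "?g ` ?B \<subseteq> ?A"
      using B by blast+
  qed
qed

lemma finite_labeled_polywrappings:
  assumes "r \<ge> 1"
  shows "finite (labeled_polywrappings d r)"
  using bij_betw_finite[OF labeled_polywrappings_bij[OF assms, of d]]
  by (simp add: finite_weak_decomps finite_PiE finite_lcomps)

text \<open>Expand each row by labeled compositions, multiply out over the rows, and read each
  resulting term as a labeled polywrapping of the block.\<close>

lemma subst_power_E_deg_expansion:
  assumes "r \<ge> 1"
  shows "subst_power r (E_deg d) = (\<Sum>D\<in>labeled_polywrappings d r.
    of_int ((-1) ^ otype_area (pocon D) * lpw_sgn r D) * h_tensor (pocon D))"
proof -
  let ?f = "\<lambda>D. (\<lambda>k\<in>{1..d}. sum_list (pocon D k) div r, \<lambda>k\<in>{1..d}. (pocon D k, labels D k))"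
  have "subst_power r (E_deg d) = (\<Sum>m\<in>weak_decomps d. \<Prod>k\<in>{1..d}. \<Sum>p\<in>lcomps r (r * m k).
      lpw_weight r k (fst p) (snd p))"
    by (simp add: subst_power_E_deg[OF assms] e_pow_eq_sum_lcomps[OF assms] lpw_weight_def case_prod_unfold)
  also have "\<dots> = (\<Sum>m\<in>weak_decomps d. \<Sum>\<phi>\<in>(\<Pi>\<^sub>E k\<in>{1..d}. lcomps r (r * m k)). \<Prod>k\<in>{1..d}.
      lpw_weight r k (fst (\<phi> k)) (snd (\<phi> k)))"
    by (intro sum.cong refl prod_sum_PiE) (auto simp: finite_lcomps)
  also have "\<dots> = (\<Sum>(m, \<phi>)\<in>(SIGMA m:weak_decomps d. \<Pi>\<^sub>E k\<in>{1..d}. lcomps r (r * m k)). \<Prod>k\<in>{1..d}.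
      lpw_weight r k (fst (\<phi> k)) (snd (\<phi> k)))"
    by (rule sum.Sigma) (auto simp: finite_weak_decomps finite_PiE finite_lcomps)
  also have "\<dots> = (\<Sum>D\<in>labeled_polywrappings d r. case ?f D of (m, \<phi>) \<Rightarrow> \<Prod>k\<in>{1..d}.
      lpw_weight r k (fst (\<phi> k)) (snd (\<phi> k)))"
    by (rule sum.reindex_bij_betw[OF labeled_polywrappings_bij[OF assms], symmetric])
  also have "\<dots> = (\<Sum>D\<in>labeled_polywrappings d r.
      of_int ((-1) ^ otype_area (pocon D) * lpw_sgn r D) * h_tensor (pocon D))"
  proof (rule sum.cong)
    fix D assume "D \<in> labeled_polywrappings d r"
    from lpw_weight_eq[OF this assms]
    show "(case ?f D of (m, \<phi>) \<Rightarrow> \<Prod>k\<in>{1..d}. lpw_weight r k (fst (\<phi> k)) (snd (\<phi> k))) =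
        of_int ((-1) ^ otype_area (pocon D) * lpw_sgn r D) * h_tensor (pocon D)"
      unfolding prod.case by (auto intro!: prod.cong)
  qed simp
  finally show ?thesis .
qed

section \<open>Linear independence of the products of complete homogeneous functions\<close>

text \<open>The image of the types of \<open>n\<close> under \<open>blocks\<close>. In this form the
  product of two \<open>h_blocks\<close> belongs to the sum of the multisets, with no sorting of
  parts.\<close>

definition block_msets :: "nat \<Rightarrow> (nat \<times> nat) multiset set" where
  "block_msets n = {M. (\<forall>(d, m)\<in>#M. d \<ge> 1 \<and> m \<ge> 1) \<and> (\<Sum>(d, m)\<in>#M. d * m) = n}"

definition h_blocks :: "(nat \<times> nat) multiset \<Rightarrow> pser" where
  "h_blocks M = (\<Prod>(d, m)\<in>#M. h_sym d m)"

definition e_blocks :: "(nat \<times> nat) multiset \<Rightarrow> pser" where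
  "e_blocks M = (\<Prod>(d, m)\<in>#M. e_pow 1 d m)"

lemma count_image_Pair: "count (image_mset (Pair d) M) (d', m) = (if d' = d then count M m else 0)"
  by (induction M) auto

lemma count_blocks:
  assumes "finite {d. \<delta> d \<noteq> []}"
  shows "count (blocks \<delta>) (d, m) = count (mset (\<delta> d)) m"
proof -
  have "count (blocks \<delta>) (d, m) = (\<Sum>d' | \<delta> d' \<noteq> []. if d' = d then count (mset (\<delta> d)) m else 0)"
    unfolding blocks_def count_sum by (intro sum.cong) (auto simp: count_image_Pair)
  also have "\<dots> = count (mset (\<delta> d)) m"
    using assms by (subst sum.delta) auto
  finally show ?thesis .
qed

lemma blocks_psort:
  assumes "finite {d. \<delta> d \<noteq> []}"
  shows "blocks (psort \<delta>) = blocks \<delta>"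
proof (rule multiset_eqI)
  fix x :: "nat \<times> nat"
  have "length (psort \<delta> d) = length (\<delta> d)" for d by (simp add: psort_def)
  then have "{d. psort \<delta> d \<noteq> []} = {d. \<delta> d \<noteq> []}" by (metis length_0_conv)
  then have "finite {d. psort \<delta> d \<noteq> []}" using assms by simp
  then show "count (blocks (psort \<delta>)) x = count (blocks \<delta>) x"
    using assms by (cases x) (simp add: count_blocks psort_def)
qed

lemma sum_blocks:
  fixes F :: "nat \<times> nat \<Rightarrow> 'a::comm_monoid_add"
  assumes "finite {d. \<delta> d \<noteq> []}"
  shows "(\<Sum>p\<in>#blocks \<delta>. F p) = (\<Sum>d | \<delta> d \<noteq> []. sum_list (map (\<lambda>m. F (d, m)) (\<delta> d)))"
proof -
  have "(\<Sum>p\<in>#(\<Sum>d\<in>A. image_mset (Pair d) (mset (\<delta> d))). F p) =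
      (\<Sum>d\<in>A. sum_list (map (\<lambda>m. F (d, m)) (\<delta> d)))" if "finite A" for A
    using that
  proof (induction A rule: finite_induct)
    case (insert d A)
    have "(\<Sum>p\<in>#image_mset (Pair d) (mset ms). F p) = sum_list (map (\<lambda>m. F (d, m)) ms)" for ms
      by (induction ms) auto
    with insert show ?case by simp
  qed simp
  then show ?thesis using assms by (simp add: blocks_def)
qed

lemma prod_blocks:
  fixes F :: "nat \<times> nat \<Rightarrow> 'a::comm_monoid_mult"
  assumes "finite {d. \<delta> d \<noteq> []}"
  shows "(\<Prod>p\<in>#blocks \<delta>. F p) = (\<Prod>d | \<delta> d \<noteq> []. prod_list (map (\<lambda>m. F (d, m)) (\<delta> d)))"
proof -
  have "(\<Prod>p\<in>#(\<Sum>d\<in>A. image_mset (Pair d) (mset (\<delta> d))). F p) =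
      (\<Prod>d\<in>A. prod_list (map (\<lambda>m. F (d, m)) (\<delta> d)))" if "finite A" for A
    using that
  proof (induction A rule: finite_induct)
    case (insert d A)
    have "(\<Prod>p\<in>#image_mset (Pair d) (mset ms). F p) = prod_list (map (\<lambda>m. F (d, m)) ms)" for ms
      by (induction ms) auto
    with insert show ?case by simp
  qed simp
  then show ?thesis using assms by (simp add: blocks_def)
qed

lemma h_tensor_eq_h_blocks:
  assumes "finite {d. \<delta> d \<noteq> []}"
  shows "h_tensor \<delta> = h_blocks (blocks \<delta>)"
  using prod_blocks[OF assms, of "\<lambda>(d, m). h_sym d m"] by (simp add: h_tensor_def h_blocks_def)

lemma blocks_in_block_msets:
  assumes "\<delta> \<in> OTyp n"
  shows "blocks \<delta> \<in> block_msets n"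
proof -
  have fin: "finite {d. \<delta> d \<noteq> []}" and "\<delta> 0 = []" and pos: "\<And>d m. m \<in> set (\<delta> d) \<Longrightarrow> m \<ge> 1"
    and w: "otype_weight \<delta> = n"
    using assms by (auto simp: OTyp_def is_otype_def)
  have "d \<ge> 1 \<and> m \<ge> 1" if "(d, m) \<in># blocks \<delta>" for d m
  proof -
    have "0 < count (blocks \<delta>) (d, m)" using that by simp
    then have "m \<in> set (\<delta> d)" unfolding count_blocks[OF fin] by simp
    then show ?thesis using \<open>\<delta> 0 = []\<close> pos by (cases d) auto
  qed
  moreover have "(\<Sum>(d, m)\<in>#blocks \<delta>. d * m) = n"
    using w by (simp add: sum_blocks[OF fin] otype_weight_def sum_list_const_mult)
  ultimately show ?thesis by (auto simp: block_msets_def)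
qed

lemma blocks_inj_on_Typ: "inj_on blocks (Typ n)"
proof (rule inj_onI, rule ext)
  fix \<sigma> \<tau> d assume "\<sigma> \<in> Typ n" "\<tau> \<in> Typ n" and eq: "blocks \<sigma> = blocks \<tau>"
  then have fin: "finite {d. \<sigma> d \<noteq> []}" "finite {d. \<tau> d \<noteq> []}"
    and srt: "sorted (rev (\<sigma> d))" "sorted (rev (\<tau> d))"
    by (auto simp: Typ_def OTyp_def is_otype_def sorted_wrt_rev)
  have "mset (\<sigma> d) = mset (\<tau> d)"
    using eq by (intro multiset_eqI) (metis count_blocks fin)
  then have "rev (\<sigma> d) = rev (\<tau> d)"
    using srt by (metis mset_rev properties_for_sort)
  then show "\<sigma> d = \<tau> d" by simp
qed

lemma blocks_image_Typ: "blocks ` Typ n = block_msets n"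
proof (intro equalityI subsetI)
  fix M assume "M \<in> blocks ` Typ n"
  then show "M \<in> block_msets n" using blocks_in_block_msets by (auto simp: Typ_def)
next
  fix M assume M: "M \<in> block_msets n"
  \<comment> \<open>The preimage lists, for each \<open>d\<close>, the second components of the
    blocks with first component \<open>d\<close> in decreasing order.\<close>
  define \<tau> where "\<tau> = (\<lambda>d. rev (sorted_list_of_multiset (image_mset snd (filter_mset (\<lambda>p. fst p = d) M))))"
  have mset_\<tau>: "mset (\<tau> d) = image_mset snd (filter_mset (\<lambda>p. fst p = d) M)" for d
    by (simp add: \<tau>_def)
  have pos: "d \<ge> 1 \<and> m \<ge> 1" if "(d, m) \<in># M" for d m
    using M that by (auto simp: block_msets_def)
  have set_\<tau>: "set (\<tau> d) = {m. (d, m) \<in># M}" for d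
    by (subst set_mset_mset[symmetric], subst mset_\<tau>) force
  have nonempty: "{d. \<tau> d \<noteq> []} = fst ` set_mset M"
    using set_\<tau> by (force simp flip: set_empty)
  then have fin: "finite {d. \<tau> d \<noteq> []}" by simp
  have "count (image_mset snd (filter_mset (\<lambda>p. fst p = d) M)) m = count M (d, m)" for d m
    by (induction M) auto
  then have blocks: "blocks \<tau> = M"
    by (intro multiset_eqI) (auto simp: count_blocks[OF fin] mset_\<tau>)
  have "is_otype \<tau>"
    using pos fin unfolding is_otype_def set_\<tau> by (force simp flip: set_empty simp: set_\<tau>)
  moreover have "otype_weight \<tau> = n"
  proof -
    have "n = (\<Sum>(d, m)\<in>#blocks \<tau>. d * m)" using M by (simp add: blocks block_msets_def)
    then show ?thesis by (simp add: sum_blocks[OF fin] otype_weight_def sum_list_const_mult)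
  qed
  moreover have "sorted_wrt (\<ge>) (\<tau> d)" for d
    by (simp add: \<tau>_def sorted_wrt_rev)
  ultimately have "\<tau> \<in> Typ n" by (simp add: Typ_def OTyp_def)
  then show "M \<in> blocks ` Typ n" using blocks by blast
qed

text \<open>Every block contributes at least 1 to the weight and at least each of its two entries,
  so there are at most \<open>n\<close> blocks, with entries at most \<open>n\<close>.\<close>

lemma finite_block_msets: "finite (block_msets n)"
proof -
  have "block_msets n \<subseteq> mset ` {xs. set xs \<subseteq> {..n} \<times> {..n} \<and> length xs \<le> n}"
  proof
    fix M assume M: "M \<in> block_msets n"
    obtain xs where xs: "mset xs = M" using ex_mset by blast
    have pos: "d \<ge> 1 \<and> m \<ge> 1" if "(d, m) \<in> set xs" for d m
      using M that xs by (auto simp: block_msets_def)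
    have sum: "sum_list (map (\<lambda>(d, m). d * m) xs) = n"
      using M xs by (auto simp: block_msets_def simp flip: sum_mset_sum_list)
    have "d \<le> n \<and> m \<le> n" if "(d, m) \<in> set xs" for d m
    proof -
      have "d * m \<le> n" using member_le_sum_list[of "d * m" "map (\<lambda>(d, m). d * m) xs"] that sum by force
      moreover have "d \<le> d * m" "m \<le> d * m" using pos[OF that] by auto
      ultimately show ?thesis by linarith
    qed
    moreover have "length xs \<le> sum_list (map (\<lambda>(d, m). d * m) xs)"
    proof -
      have "sum_list (map (\<lambda>_. 1) xs) \<le> sum_list (map (\<lambda>(d, m). d * m) xs)"
        using pos by (intro sum_list_mono) fastforce
      then show ?thesis by (simp add: sum_list_triv)
    qed
    ultimately show "M \<in> mset ` {xs. set xs \<subseteq> {..n} \<times> {..n} \<and> length xs \<le> n}"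
      using xs sum by (intro image_eqI[of _ _ xs]) auto
  qed
  then show ?thesis by (rule finite_subset) (intro finite_imageI finite_lists_length_le, simp)
qed

section \<open>Elementary products in the span of the complete homogeneous ones\<close>

lemma h_blocks_union: "h_blocks (M + N) = h_blocks M * h_blocks N"
  by (simp add: h_blocks_def)

lemma block_msets_union: "M \<in> block_msets a \<Longrightarrow> N \<in> block_msets b \<Longrightarrow> M + N \<in> block_msets (a + b)"
  by (auto simp: block_msets_def)

lemma pscale_times: "pscale c F * G = pscale c (F * G)" "G * pscale c F = pscale c (G * F)"
  by (auto intro!: pser_eqI simp: coeff_times pscale_def sum_distrib_left intro!: sum.cong)

lemma span_h_blocks_times:
  assumes "F \<in> pser.span (h_blocks ` block_msets a)" "G \<in> pser.span (h_blocks ` block_msets b)"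
  shows "F * G \<in> pser.span (h_blocks ` block_msets (a + b))"
  using assms(1)
proof (induction rule: pser.span_induct_alt)
  case base
  then show ?case by (simp add: pser.span_zero)
next
  case (step c x y)
  then obtain M where M: "x = h_blocks M" "M \<in> block_msets a" by blast
  from assms(2) have "x * G \<in> pser.span (h_blocks ` block_msets (a + b))"
  proof (induction rule: pser.span_induct_alt)
    case base
    then show ?case by (simp add: pser.span_zero)
  next
    case (step c x' y')
    then obtain N where "x' = h_blocks N" "N \<in> block_msets b" by blast
    then have "x * x' \<in> pser.span (h_blocks ` block_msets (a + b))"
      using M block_msets_union h_blocks_union by (metis imageI pser.span_base)
    then show ?case using step
      by (simp add: distrib_left pscale_times pser.span_add pser.span_scale)
  qed
  then show ?case using step by (simp add: distrib_right pscale_times pser.span_add pser.span_scale)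
qed

text \<open>Each composition in the expansion of \<open>e_pow 1 i m\<close> gives, up to sign, the
  product of the blocks of index \<open>i\<close> whose sizes are its parts.\<close>

lemma e_pow_in_span:
  assumes "i \<ge> 1"
  shows "e_pow 1 i m \<in> pser.span (h_blocks ` block_msets (i * m))"
  unfolding e_pow_eq_sum_comps
proof (rule pser.span_sum)
  fix \<beta> assume \<beta>: "\<beta> \<in> comps m"
  have eq: "prod_list (map (\<lambda>k. - h_sym i k) \<beta>) = pscale ((-1) ^ length \<beta>) (h_blocks (image_mset (Pair i) (mset \<beta>)))" for \<beta>
  proof -
    have "prod_list (map (h_sym i) \<beta>) = h_blocks (image_mset (Pair i) (mset \<beta>))"
      by (induction \<beta>) (auto simp: h_blocks_def)
    then show ?thesis
      using of_int_times_pser[of "(-1) ^ length \<beta>"] by (simp add: prod_list_uminus_map)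
  qed
  have "(\<Sum>(d, m)\<in>#image_mset (Pair i) (mset \<beta>). d * m) = i * sum_list \<beta>"
    by (induction \<beta>) (auto simp: distrib_left)
  then have "image_mset (Pair i) (mset \<beta>) \<in> block_msets (i * m)"
    using \<beta> assms by (auto simp: block_msets_def comps_def Suc_le_eq intro: ccontr)
  then show "prod_list (map (\<lambda>k. - h_sym i k) \<beta>) \<in> pser.span (h_blocks ` block_msets (i * m))"
    unfolding eq by (intro pser.span_scale pser.span_base imageI)
qed

lemma e_blocks_in_span:
  assumes "M \<in> block_msets n"
  shows "e_blocks M \<in> pser.span (h_blocks ` block_msets n)"
  using assms
proof (induction M arbitrary: n)
  case empty
  have "h_blocks {#} = 1" "{#} \<in> block_msets 0" by (simp_all add: h_blocks_def block_msets_def)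
  then have "1 \<in> pser.span (h_blocks ` block_msets 0)" by (metis imageI pser.span_base)
  then show ?case using empty by (simp add: e_blocks_def block_msets_def)
next
  case (add p M)
  obtain d m where p: "p = (d, m)" by (cases p)
  have "d \<ge> 1" "M \<in> block_msets (n - d * m)" "n = d * m + (n - d * m)"
    using add.prems by (auto simp: block_msets_def p)
  then have "e_pow 1 d m * e_blocks M \<in> pser.span (h_blocks ` block_msets n)"
    using span_h_blocks_times[OF e_pow_in_span add.IH] by metis
  then show ?case by (simp add: e_blocks_def p)
qed

section \<open>Leading monomials and linear independence\<close>

text \<open>Monomials are compared lexicographically, by the exponents at the first variable where
  they differ, the variables being ordered by row and then by column.\<close>

definition lead :: "pser \<Rightarrow> monomial \<Rightarrow> bool" where
  "lead F f \<longleftrightarrow> coeff F f \<noteq> 0 \<and> (\<forall>g. coeff F g \<noteq> 0 \<longrightarrow> g \<le> f)"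

lemma lead_unique: "lead F f \<Longrightarrow> lead F g \<Longrightarrow> f = g"
  by (auto simp: lead_def intro: antisym)

text \<open>The order is compatible with addition, so \<open>f + g\<close> arises only from the pair
  \<open>(f, g)\<close> and cannot cancel.\<close>

lemma lead_times:
  assumes "lead F f" "lead G g"
  shows "lead (F * G) (f + g)"
proof -
  have F: "a \<le> f" if "coeff F a \<noteq> 0" for a using assms(1) that by (simp add: lead_def)
  have G: "b \<le> g" if "coeff G b \<noteq> 0" for b using assms(2) that by (simp add: lead_def)
  have "coeff (F * G) (f + g) = (\<Sum>(a, b)\<in>{(f, g)}. coeff F a * coeff G b)"
    unfolding coeff_times
  proof (rule sum.mono_neutral_right)
    show "\<forall>p\<in>{(a, b). a + b = f + g} - {(f, g)}. (case p of (a, b) \<Rightarrow> coeff F a * coeff G b) = 0"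
    proof (rule ballI, rule ccontr)
      fix p assume p: "p \<in> {(a, b). a + b = f + g} - {(f, g)}" "(case p of (a, b) \<Rightarrow> coeff F a * coeff G b) \<noteq> 0"
      obtain a b where "p = (a, b)" by (cases p)
      with p have ab: "a + b = f + g" "(a, b) \<noteq> (f, g)" "coeff F a * coeff G b \<noteq> 0" by auto
      then have le: "a \<le> f" "b \<le> g" using F G by auto
      then have "a = f"
        using ab(1) add_less_le_mono[of a f b g] by (metis le_less less_irrefl)
      then show False using ab by simp
    qed
  qed (auto simp: finite_splits)
  then have "coeff (F * G) (f + g) \<noteq> 0" using assms by (simp add: lead_def)
  moreover have "h \<le> f + g" if "coeff (F * G) h \<noteq> 0" for h
    using that by (rule coeff_times_nonzero) (auto intro: add_mono F G)
  ultimately show ?thesis by (simp add: lead_def)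
qed

text \<open>In a linear relation, the largest leading monomial among the terms with nonzero
  coefficient occurs in no other such term, so its coefficient cannot vanish.\<close>

lemma lead_independent:
  assumes "finite P" and lead: "\<And>M. M \<in> P \<Longrightarrow> lead (E M) (L M)" and inj: "inj_on L P"
  shows "inj_on E P" "\<not> pser.dependent (E ` P)"
proof -
  show injE: "inj_on E P"
    using lead inj lead_unique by (metis inj_on_def)
  show "\<not> pser.dependent (E ` P)"
  proof (rule pser.independent_if_scalars_zero)
    show "finite (E ` P)" using assms(1) by simp
    fix c x assume sum: "(\<Sum>x\<in>E ` P. pscale (c x) x) = 0" and x: "x \<in> E ` P"
    define Q where "Q = {M \<in> P. c (E M) \<noteq> 0}"
    show "c x = 0"
    proof (rule ccontr)
      assume "c x \<noteq> 0"
      then have "Q \<noteq> {}" using x by (auto simp: Q_def)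
      moreover have finQ: "finite Q" using assms(1) by (simp add: Q_def)
      ultimately have "Max (L ` Q) \<in> L ` Q" by (intro Max_in) auto
      then obtain M where M: "M \<in> Q" "L M = Max (L ` Q)" by auto
      have "0 = coeff (\<Sum>x\<in>E ` P. pscale (c x) x) (L M)" by (simp add: sum)
      also have "\<dots> = (\<Sum>N\<in>P. c (E N) * coeff (E N) (L M))"
        by (simp add: coeff_sum sum.reindex[OF injE] pscale_def)
      also have "\<dots> = (\<Sum>N\<in>{M}. c (E N) * coeff (E N) (L M))"
      proof (rule sum.mono_neutral_right)
        show "\<forall>N\<in>P - {M}. c (E N) * coeff (E N) (L M) = 0"
        proof (rule ballI, rule ccontr)
          fix N assume N: "N \<in> P - {M}" "c (E N) * coeff (E N) (L M) \<noteq> 0"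
          then have "N \<in> Q" "L M \<le> L N" using lead[of N] by (auto simp: Q_def lead_def)
          then have "L M = L N" using M finQ by (auto intro!: antisym)
          then show False using N M inj by (auto simp: Q_def dest: inj_onD)
        qed
      qed (use M assms(1) in \<open>auto simp: Q_def\<close>)
      finally show False using M(1) lead[of M] by (auto simp: Q_def lead_def)
    qed
  qed
qed

definition e_lead :: "nat \<Rightarrow> nat \<Rightarrow> monomial" where
  "e_lead i m = (\<Sum>j\<in>{1..m}. Poly_Mapping.single (i, j) 1)"

lemma lookup_e_lead: "Poly_Mapping.lookup (e_lead i m) v = (if v \<in> {i} \<times> {1..m} then 1 else 0)"
proof -
  obtain a b where v: "v = (a, b)" by (cases v)
  have "Poly_Mapping.lookup (e_lead i m) v = (\<Sum>j\<in>{1..m}. if j = b then (if i = a then 1 else 0) else 0)"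
    unfolding e_lead_def lookup_sum v by (intro sum.cong) (auto simp: lookup_single when_def)
  then show ?thesis by (simp add: v)
qed

text \<open>The leading monomial is the product of the first \<open>m\<close> variables of the row.
  At its first difference from this product, a larger square-free monomial would have to gain a
  variable beyond column \<open>m\<close> while keeping the first \<open>m\<close>, one variable too
  many.\<close>

lemma lead_e_pow: "lead (e_pow 1 i m) (e_lead i m)"
proof -
  have "Poly_Mapping.keys (e_lead i m) = {i} \<times> {1..m}"
    by (auto simp: in_keys_iff lookup_e_lead split: if_splits)
  then have "coeff (e_pow 1 i m) (e_lead i m) \<noteq> 0"
    by (auto simp: e_pow_def lookup_e_lead card_cartesian_product)
  moreover have "g \<le> e_lead i m" if "coeff (e_pow 1 i m) g \<noteq> 0" for g
  proof (rule ccontr)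
    have g: "Poly_Mapping.keys g \<subseteq> {i} \<times> {1..}" "card (Poly_Mapping.keys g) = m"
      using that by (auto simp: e_pow_def split: if_splits)
    assume "\<not> g \<le> e_lead i m"
    then have "less_fun (Poly_Mapping.lookup (e_lead i m)) (Poly_Mapping.lookup g)"
      by (simp add: not_le less_poly_mapping.rep_eq)
    then obtain k where k: "Poly_Mapping.lookup (e_lead i m) k < Poly_Mapping.lookup g k"
      and below: "\<And>k'. k' < k \<Longrightarrow> Poly_Mapping.lookup (e_lead i m) k' = Poly_Mapping.lookup g k'"
      by (auto simp: less_fun_def simp del: split_paired_All split_paired_Ex)
    have "k \<in> Poly_Mapping.keys g" using k by (auto simp: in_keys_iff)
    moreover from this obtain j where j: "k = (i, j)" "j \<ge> 1" using g by auto
    moreover have "j > m"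
    proof (rule ccontr)
      assume "\<not> j > m"
      then have "Poly_Mapping.lookup g k > 1" using k j by (simp add: lookup_e_lead)
      moreover have "Poly_Mapping.lookup g k = 1"
        using that \<open>k \<in> Poly_Mapping.keys g\<close> by (auto simp: e_pow_def split: if_splits)
      ultimately show False by simp
    qed
    moreover have "(i, j') \<in> Poly_Mapping.keys g" if "j' \<in> {1..m}" for j'
      using below[of "(i, j')"] that j \<open>j > m\<close> by (simp add: in_keys_iff lookup_e_lead)
    ultimately have "insert k ({i} \<times> {1..m}) \<subseteq> Poly_Mapping.keys g" by auto
    then have "card (insert k ({i} \<times> {1..m})) \<le> m"
      using g(2) card_mono[OF finite_keys] by metis
    then show False using j \<open>j > m\<close> by (simp add: card_insert_if card_cartesian_product)
  qed
  ultimately show ?thesis by (simp add: lead_def)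
qed

lemma lead_e_blocks: "lead (e_blocks M) (\<Sum>(d, m)\<in>#M. e_lead d m)"
proof (induction M)
  case empty
  show ?case by (auto simp: e_blocks_def lead_def coeff_1)
next
  case (add p M)
  then show ?case using lead_times[OF lead_e_pow add.IH] by (cases p) (simp add: e_blocks_def)
qed

text \<open>The exponent of the variable \<open>(i, j)\<close> in the leading monomial counts the
  blocks \<open>(i, m)\<close> with \<open>m \<ge> j\<close>, so differences of neighbouring
  exponents recover all multiplicities.\<close>

lemma inj_on_e_lead: "inj_on (\<lambda>M. \<Sum>(d, m)\<in>#M. e_lead d m) (block_msets n)"
proof (rule inj_onI, rule multiset_eqI)
  let ?L = "\<lambda>M. \<Sum>(d, m)\<in>#M. e_lead d m"
  fix M N and p :: "nat \<times> nat" assume M: "M \<in> block_msets n" and N: "N \<in> block_msets n" and eq: "?L M = ?L N"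
  obtain i j where p: "p = (i, j)" by (cases p)
  show "count M p = count N p"
  proof (cases "j \<ge> 1")
    case True
    have "Poly_Mapping.lookup (?L M) (i, j) = count M (i, j) + Poly_Mapping.lookup (?L M) (i, Suc j)" for M
      using True by (induction M) (auto simp: lookup_add lookup_e_lead split: if_splits)
    from this[of M] this[of N] show ?thesis by (simp add: p eq)
  next
    case False
    then have "p \<notin># M" "p \<notin># N" using M N p by (auto simp: block_msets_def)
    then show ?thesis by (simp add: not_in_iff)
  qed
qed

text \<open>A dimension count: the products \<open>e_blocks\<close> are independent, lie in the span
  of the \<open>h_tensor\<close>, and are as many as the types. Hence the \<open>h_tensor\<close>
  are distinct and independent.\<close>

lemma h_tensor_independent:
  shows "inj_on h_tensor (Typ n)" "\<not> pser.dependent (h_tensor ` Typ n)"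
proof -
  let ?T = "Typ n" and ?P = "block_msets n"
  have fin: "finite ?P" by (rule finite_block_msets)
  have finT: "finite ?T" using fin unfolding blocks_image_Typ[symmetric] by (rule finite_imageD[OF _ blocks_inj_on_Typ])
  have cardT: "card ?T = card ?P"
    unfolding blocks_image_Typ[symmetric] by (rule card_image[OF blocks_inj_on_Typ, symmetric])
  have "h_tensor \<tau> = h_blocks (blocks \<tau>)" if "\<tau> \<in> ?T" for \<tau>
    using that by (intro h_tensor_eq_h_blocks) (auto simp: Typ_def OTyp_def is_otype_def)
  then have img: "h_tensor ` ?T = h_blocks ` ?P"
    unfolding blocks_image_Typ[symmetric] image_image by simp
  note ind = lead_independent[OF fin lead_e_blocks inj_on_e_lead]
  have sub: "e_blocks ` ?P \<subseteq> pser.span (h_tensor ` ?T)"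
    unfolding img using e_blocks_in_span by blast
  have bound: "card ?P \<le> card S" if "finite S" "e_blocks ` ?P \<subseteq> pser.span S" for S
    using pser.independent_span_bound[OF that(1) ind(2) that(2)] ind(1) by (simp add: card_image)
  have "card (h_tensor ` ?T) = card ?T"
    using bound[OF _ sub] finT card_image_le[OF finT, of h_tensor] cardT by simp
  then show "inj_on h_tensor ?T" by (rule eq_card_imp_inj_on[OF finT])
  show "\<not> pser.dependent (h_tensor ` ?T)"
  proof
    assume "pser.dependent (h_tensor ` ?T)"
    then obtain a where a: "a \<in> h_tensor ` ?T" "a \<in> pser.span (h_tensor ` ?T - {a})"
      by (auto simp: pser.dependent_def)
    \<comment> \<open>Under a dependence one member could be dropped without shrinking the span,
      leaving fewer vectors than \<open>bound\<close> permits.\<close>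
    then have "pser.span (h_tensor ` ?T) = pser.span (h_tensor ` ?T - {a})"
      using pser.span_redundant[of a "h_tensor ` ?T - {a}"] by (simp add: insert_absorb)
    then have "card ?P \<le> card (h_tensor ` ?T - {a})"
      using sub finT by (intro bound) auto
    also have "\<dots> < card (h_tensor ` ?T)" using a(1) finT by (intro card_Diff1_less) auto
    also have "\<dots> \<le> card ?P" using card_image_le[OF finT, of h_tensor] cardT by simp
    finally show False by simp
  qed
qed

section \<open>Block tabloids\<close>

definition content :: "lpw list \<Rightarrow> (nat \<times> nat) multiset" where
  "content T = sum_list (map (\<lambda>D. blocks (psort (pocon D))) T)"

definition block_area :: "(nat \<times> nat) multiset \<Rightarrow> nat" where
  "block_area M = (\<Sum>p\<in>#M. snd p)"

lemma block_area_blocks: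
  assumes "finite {d. \<delta> d \<noteq> []}"
  shows "block_area (blocks \<delta>) = otype_area \<delta>"
  using sum_blocks[OF assms, of snd] by (simp add: block_area_def otype_area_def)

text \<open>Tabloids with the content left free: these index the full expansion of the product over
  the blocks before it is sorted by content.\<close>

definition tabloids_of_shape :: "(nat \<times> nat) list \<Rightarrow> lpw list set" where
  "tabloids_of_shape bs = {T. list_all2 (\<lambda>b D. D \<in> labeled_polywrappings (fst b) (snd b)) bs T}"

lemma tabloids_eq: "tabloids bs \<tau> = {T \<in> tabloids_of_shape bs. content T = blocks \<tau>}"
  by (simp add: tabloids_def tabloids_of_shape_def content_def case_prod_unfold)

text \<open>The area is additive and \<open>h_blocks\<close> multiplicative over the blocks of the
  contents. The accumulated sign and product therefore depend on the entries only through
  \<open>tabloid_sgn\<close> and the total content.\<close>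

lemma tabloid_content_weight:
  assumes "list_all2 (\<lambda>b D. D \<in> labeled_polywrappings (fst b) (snd b)) bs T"
  shows "prod_list (map2 (\<lambda>b D. of_int ((-1) ^ otype_area (pocon D) * lpw_sgn (snd b) D) * h_tensor (pocon D)) bs T) =
      of_int ((-1) ^ block_area (content T) * tabloid_sgn bs T) * h_blocks (content T) \<and>
    content T \<in> block_msets (sum_list (map (\<lambda>b. fst b * snd b) bs))"
  using assms
proof (induction rule: list_all2_induct)
  case Nil
  show ?case by (simp add: content_def block_area_def tabloid_sgn_def h_blocks_def block_msets_def)
next
  case (Cons b bs D T)
  have ot: "pocon D \<in> OTyp (fst b * snd b)"
    using Cons.hyps(1) by (simp add: labeled_polywrappings_def OTyp_div_def)
  then have fin: "finite {d. pocon D d \<noteq> []}" by (simp add: OTyp_def is_otype_def)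
  have content: "content (D # T) = blocks (pocon D) + content T"
    by (simp add: content_def blocks_psort[OF fin])
  have area: "block_area (content (D # T)) = otype_area (pocon D) + block_area (content T)"
    by (simp add: content block_area_blocks[OF fin, symmetric] block_area_def)
  have sgn: "tabloid_sgn (b # bs) (D # T) = lpw_sgn (snd b) D * tabloid_sgn bs T"
    by (simp add: tabloid_sgn_def case_prod_unfold)
  have h: "h_blocks (content (D # T)) = h_tensor (pocon D) * h_blocks (content T)"
    by (simp add: content h_blocks_union h_tensor_eq_h_blocks[OF fin])
  show ?case
    using Cons.IH block_msets_union[OF blocks_in_block_msets[OF ot], of "content T"]
    unfolding area sgn h by (simp add: content power_add mult_ac)
qed

lemma E_type_expansion:
  assumes "mset bs = blocks \<sigma>" "\<sigma> \<in> Typ n"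
  shows "E_type \<sigma> = (\<Sum>\<tau>\<in>Typ n.
    pscale (of_int ((-1) ^ otype_area \<tau> * (\<Sum>T\<in>tabloids bs \<tau>. tabloid_sgn bs T))) (h_tensor \<tau>))"
proof -
  let ?S = "tabloids_of_shape bs"
  let ?w = "\<lambda>T. of_int ((-1) ^ block_area (content T) * tabloid_sgn bs T) * h_blocks (content T)"
  have bm: "blocks \<sigma> \<in> block_msets n" using assms(2) blocks_in_block_msets by (auto simp: Typ_def)
  have pos: "snd b \<ge> 1" if "b \<in> set bs" for b
  proof -
    have "b \<in># blocks \<sigma>" using that assms(1) by (metis set_mset_mset)
    then show ?thesis using bm by (cases b) (auto simp: block_msets_def)
  qed
  have "(\<Sum>(d, r)\<in>#mset bs. d * r) = sum_list (map (\<lambda>(d, r). d * r) bs)"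
    by (metis mset_map sum_mset_sum_list)
  then have "sum_list (map (\<lambda>(d, r). d * r) bs) = n"
    using bm by (simp add: block_msets_def flip: assms(1))
  then have weight: "sum_list (map (\<lambda>b. fst b * snd b) bs) = n"
    by (simp add: case_prod_unfold)
  have fin: "finite (labeled_polywrappings (fst b) (snd b))" if "b \<in> set bs" for b
    using pos[OF that] by (rule finite_labeled_polywrappings)
  have finS: "finite ?S"
    unfolding tabloids_of_shape_def by (rule finite_list_all2) (rule fin)
  have "E_type \<sigma> = prod_list (map (\<lambda>b. subst_power (snd b) (E_deg (fst b))) bs)"
  proof -
    have "(\<Prod>b\<in>#mset bs. f b) = prod_list (map f bs)" for f :: "nat \<times> nat \<Rightarrow> pser"
      by (metis mset_map prod_mset_prod_list)
    then show ?thesis unfolding E_type_def assms(1)[symmetric] by (simp add: case_prod_unfold)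
  qed
  also have "\<dots> = prod_list (map (\<lambda>b. \<Sum>D\<in>labeled_polywrappings (fst b) (snd b).
      of_int ((-1) ^ otype_area (pocon D) * lpw_sgn (snd b) D) * h_tensor (pocon D)) bs)"
    using pos by (intro arg_cong[where f = prod_list] map_cong refl subst_power_E_deg_expansion)
  also have "\<dots> = (\<Sum>T\<in>?S. prod_list (map2 (\<lambda>b D.
      of_int ((-1) ^ otype_area (pocon D) * lpw_sgn (snd b) D) * h_tensor (pocon D)) bs T))"
    unfolding tabloids_of_shape_def by (rule sum_list_all2_prod[symmetric]) (rule fin)
  also have "\<dots> = (\<Sum>T\<in>?S. ?w T)"
    by (intro sum.cong refl) (use tabloid_content_weight in \<open>auto simp: tabloids_of_shape_def\<close>)
  also have "\<dots> = (\<Sum>M\<in>block_msets n. \<Sum>T | T \<in> ?S \<and> content T = M. ?w T)"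
  proof (rule sum.group[symmetric, OF finS finite_block_msets])
    show "content ` ?S \<subseteq> block_msets n"
      using tabloid_content_weight weight by (auto simp: tabloids_of_shape_def)
  qed
  \<comment> \<open>The contents range over multisets of blocks; \<open>blocks\<close> replaces them
    bijectively by types.\<close>
  also have "\<dots> = (\<Sum>\<tau>\<in>Typ n. \<Sum>T\<in>tabloids bs \<tau>. ?w T)"
    unfolding blocks_image_Typ[symmetric] tabloids_eq
    by (rule sum.reindex[OF blocks_inj_on_Typ, unfolded o_def])
  also have "\<dots> = (\<Sum>\<tau>\<in>Typ n.
      pscale (of_int ((-1) ^ otype_area \<tau> * (\<Sum>T\<in>tabloids bs \<tau>. tabloid_sgn bs T))) (h_tensor \<tau>))"
  proof (rule sum.cong)
    fix \<tau> assume "\<tau> \<in> Typ n"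
    then have "finite {d. \<tau> d \<noteq> []}" by (simp add: Typ_def OTyp_def is_otype_def)
    note \<tau> = block_area_blocks[OF this] h_tensor_eq_h_blocks[OF this]
    have "(\<Sum>T\<in>tabloids bs \<tau>. ?w T) =
        (\<Sum>T\<in>tabloids bs \<tau>. of_int ((-1) ^ otype_area \<tau> * tabloid_sgn bs T) * h_tensor \<tau>)"
      by (rule sum.cong) (simp_all add: tabloids_eq \<tau>)
    also have "\<dots> = of_int ((-1) ^ otype_area \<tau> * (\<Sum>T\<in>tabloids bs \<tau>. tabloid_sgn bs T)) * h_tensor \<tau>"
      by (simp add: sum_distrib_left sum_distrib_right)
    finally show "(\<Sum>T\<in>tabloids bs \<tau>. ?w T) =
        pscale (of_int ((-1) ^ otype_area \<tau> * (\<Sum>T\<in>tabloids bs \<tau>. tabloid_sgn bs T))) (h_tensor \<tau>)"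
      unfolding of_int_times_pser .
  qed simp
  finally show ?thesis .
qed

section \<open>Reading off the coefficients\<close>

lemma h_coeff_sum:
  assumes "\<tau> \<in> Typ n"
  shows "h_coeff n (\<Sum>\<tau>\<in>Typ n. pscale (c \<tau>) (h_tensor \<tau>)) \<tau> = c \<tau>"
proof -
  let ?B = "h_tensor ` Typ n"
  note ind = h_tensor_independent(2)[of n]
  have span: "h_tensor \<tau>' \<in> pser.span ?B" if "\<tau>' \<in> Typ n" for \<tau>'
    using that by (intro pser.span_base imageI)
  have finT: "finite (Typ n)"
    using finite_block_msets[of n] unfolding blocks_image_Typ[symmetric]
    by (rule finite_imageD[OF _ blocks_inj_on_Typ])
  have "h_coeff n (\<Sum>\<tau>\<in>Typ n. pscale (c \<tau>) (h_tensor \<tau>)) \<tau> =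
      (\<Sum>\<tau>'\<in>Typ n. pser.representation ?B (pscale (c \<tau>') (h_tensor \<tau>')) (h_tensor \<tau>))"
    unfolding h_coeff_def
    by (subst pser.representation_sum[OF ind]) (auto intro: pser.span_scale span)
  also have "\<dots> = (\<Sum>\<tau>'\<in>Typ n. if \<tau>' = \<tau> then c \<tau>' else 0)"
  proof (rule sum.cong)
    fix \<tau>' assume \<tau>': "\<tau>' \<in> Typ n"
    \<comment> \<open>The representation is indexed by basis vectors and not by types; injectivity
      ensures that no other type contributes to the same vector.\<close>
    then have "h_tensor \<tau> = h_tensor \<tau>' \<longleftrightarrow> \<tau>' = \<tau>"
      using inj_onD[OF h_tensor_independent(1)] assms by blast
    then show "pser.representation ?B (pscale (c \<tau>') (h_tensor \<tau>')) (h_tensor \<tau>) = (if \<tau>' = \<tau> then c \<tau>' else 0)"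
      using \<tau>' by (simp add: pser.representation_scale[OF ind span] pser.representation_basis[OF ind])
  qed simp
  finally show ?thesis using assms finT by simp
qed

theorem theorem71:
  fixes n :: nat and \<sigma> \<tau> :: otype and bs :: "(nat \<times> nat) list"
  assumes "n \<ge> 1" and "\<sigma> \<in> Typ n" and "\<tau> \<in> Typ n"
    and "mset bs = blocks \<sigma>"
  shows "h_coeff n (E_type \<sigma>) \<tau> =
    of_int ((-1) ^ otype_area \<tau> * (\<Sum>T\<in>tabloids bs \<tau>. tabloid_sgn bs T))"
  unfolding E_type_expansion[OF assms(4,2)] by (rule h_coeff_sum[OF assms(3)])

end
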